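(* Let $S=(S_d)_{d\in\mathbb{N}}$ be a sequence of compact linear operators $S_d\colon H_d\to G_d$ between Hilbert spaces, with ordered squared singular values $(\lambda_{d,j})_{j\in\mathbb{N}}$, and consider the worst case setting with respect to the absolute ($\mathrm{crit}=\mathrm{abs}$) or normalized ($\mathrm{crit}=\mathrm{norm}$) error criterion for the class $\Lambda^{\mathrm{all}}$. Let $s,t>0$ and $0<\overline{\beta}<1$ be fixed. Then $S$ is $(s,t)$-weakly tractable if and only if the following two conditions hold: (1) For every $d\in\mathbb{N}$, $$\lim_{j\to\infty} \frac{\lambda_{d,j}}{\mathrm{CRI}_d}\,\ln^{2/s} j = 0.$$ (2) There exists a function $f_{s,t}\colon (0,\overline{\beta}]\to\mathbb{N}$ such that $$L_{s,t}:=\sup_{\beta\in(0,\overline{\beta}]} \frac{1}{\beta^{2/s}} \sup_{\substack{d\in\mathbb{N},\\ d\ge f_{s,t}(\beta)}}\ \sup_{\substack{j\in\mathbb{N},\\ j\ge \lceil \exp(d^{t}\sqrt{\beta})\rceil+1}} \frac{\lambda_{d,j}}{\mathrm{CRI}_d}\,\ln^{2/s} j<\infty.$$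
   Context: Setting. For every $d\in\mathbb{N}=\{1,2,\dots\}$, $H_d$ is an infinite dimensional separable Hilbert space, $G_d$ is a Hilbert space, and $S_d\colon H_d\to G_d$ is a compact linear operator. Let $\lambda_{d,1}\ge\lambda_{d,2}\ge\dots\ge 0$ be the eigenvalues (counted with multiplicity, in non-increasing order) of the positive semi-definite, self-adjoint, compact operator $W_d:=S_d^*\circ S_d\colon H_d\to H_d$, i.e. the squared singular values of $S_d$. It is assumed that $\lambda_{d,1}>0$ for all $d$. Worst case setting for $\Lambda^{\mathrm{all}}$. For $n\in\mathbb{N}_0$ let $e(n,d):=\inf_{A}\sup_{\|f\|_{H_d}\le 1}\|S_d f-A f\|_{G_d}$, the infimum being over all (deterministic, linear, non-adaptive) algorithms $A\colon H_d\to G_d$ using at most $n$ continuous linear functionals of $f$. The initial error is $\epsilon_d^{\mathrm{init}}:=e(0,d)=\|S_d\|=\lambda_{d,1}^{1/2}$. The information complexities for the absolute and normalized error criterion are $n^{\mathrm{abs}}(\epsilon,S_d):=\min\{n\in\mathbb{N}_0 : e(n,d)\le\epsilon\}$ and $n^{\mathrm{norm}}(\epsilon,S_d):=\min\{n\in\mathbb{N}_0 : e(n,d)\le\epsilon\cdot\epsilon_d^{\mathrm{init}}\}$. It is well known that $e(n,d)=\sqrt{\lambda_{d,n+1}}$. Put $\mathrm{CRI}_d:=1$ if $\mathrm{crit}=\mathrm{abs}$ and $\mathrm{CRI}_d:=\lambda_{d,1}$ if $\mathrm{crit}=\mathrm{norm}$. $(s,t)$-weak tractability. For fixed $s,t\ge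 0$, $S$ is called $(s,t)$-weakly tractable (for the given criterion) if $$\lim_{\epsilon^{-1}+d\to\infty}\frac{\ln n^{\mathrm{crit}}(\epsilon,S_d)}{\epsilon^{-s}+d^{t}}=0,$$ where the limit is taken along all sequences $((\epsilon_k,d_k))_{k\in\mathbb{N}}\subset(0,1]\times\mathbb{N}$ with $\epsilon_k^{-1}+d_k\to\infty$ and, for all $k$, $\epsilon_k<\epsilon_{d_k}^{\mathrm{init}}$ if $\mathrm{crit}=\mathrm{abs}$, respectively $\epsilon_k<1$ if $\mathrm{crit}=\mathrm{norm}$. Notation. $\ln^{2/s} j$ means $[\ln(j)]^{2/s}$, and $\lceil x\rceil$ is the smallest natural number larger than or equal to $x>0$. *)

theory Defs
  imports "HOL-Analysis.Analysis"
begin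

(* A complete real normed field (with multiplicative norm) is \<real> or \<complex>, by Gelfand-Mazur; so
   'k below ranges over the usual scalar fields.  The library's real inner product x \<bullet> y
   is the real part of the 'k-valued one, which is recovered by polarization. *)
locale hilbert_scalars = vector_space sc
  for sc :: "'k::{real_normed_field,banach} \<Rightarrow> 'a::real_inner \<Rightarrow> 'a" +
  assumes sc_of_real: "sc (of_real r) x = r *\<^sub>R x"
    and norm_sc: "norm (sc c x) = norm c * norm x"

lemma hilbert_scalars_real: "hilbert_scalars (scaleR :: real \<Rightarrow> 'a::real_inner \<Rightarrow> 'a)"
  by unfold_locales (auto simp: algebra_simps)

lemma hilbert_scalars_complex: "hilbert_scalars ((*) :: complex \<Rightarrow> complex \<Rightarrow> complex)"
  by unfold_locales (auto simp: algebra_simps scaleR_conv_of_real norm_mult)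

(* The members of a sequence of Hilbert spaces are rendered as complete subspaces of one
   inner product space (such as their Hilbert sum); up to isometry this is no restriction. *)
definition hilbert_space_on ::
    "('k::{real_normed_field,banach} \<Rightarrow> 'a::real_inner \<Rightarrow> 'a) \<Rightarrow> 'a set \<Rightarrow> bool" where
  "hilbert_space_on sc X \<longleftrightarrow> module.subspace sc X \<and> complete X"

definition infinite_dimensional_on ::
    "('k::{real_normed_field,banach} \<Rightarrow> 'a::real_inner \<Rightarrow> 'a) \<Rightarrow> 'a set \<Rightarrow> bool" where
  "infinite_dimensional_on sc X \<longleftrightarrow> \<not> (\<exists>B. finite B \<and> B \<subseteq> X \<and> X \<subseteq> module.span sc B)"

definition linear_map_on ::
    "('k \<Rightarrow> 'a::real_inner \<Rightarrow> 'a) \<Rightarrow> ('k \<Rightarrow> 'b \<Rightarrow> 'b) \<Rightarrow> 'a set \<Rightarrow> ('a \<Rightarrow> 'b::real_normed_vector) \<Rightarrow> bool" where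
  "linear_map_on scA scB X T \<longleftrightarrow>
     (\<forall>x\<in>X. \<forall>y\<in>X. T (x + y) = T x + T y) \<and> (\<forall>c. \<forall>x\<in>X. T (scA c x) = scB c (T x))"

definition compact_operator_on ::
    "('k \<Rightarrow> 'a::real_inner \<Rightarrow> 'a) \<Rightarrow> ('k \<Rightarrow> 'b \<Rightarrow> 'b) \<Rightarrow> 'a set \<Rightarrow> 'b set \<Rightarrow> ('a \<Rightarrow> 'b::real_inner) \<Rightarrow> bool" where
  "compact_operator_on scA scB X Y T \<longleftrightarrow>
     linear_map_on scA scB X T \<and> T ` X \<subseteq> Y \<and> compact (closure (T ` {x \<in> X. norm x \<le> 1}))"

(* Taking the adjoint with respect to the real parts of the inner products gives the same operator. *)
definition adjoint_on :: "'a::real_inner set \<Rightarrow> ('a \<Rightarrow> 'b::real_inner) \<Rightarrow> 'b \<Rightarrow> 'a" where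
  "adjoint_on X T y = (THE z. z \<in> X \<and> (\<forall>x\<in>X. T x \<bullet> y = x \<bullet> z))"

(* (lam j) for j \<ge> 1 lists the eigenvalues of the positive semi-definite compact operator W in
   non-increasing order, each positive one as often as its multiplicity.  For a compact W this
   determines lam on j \<ge> 1: if W has finite rank the list is continued by zeros, and otherwise
   it consists of the positive eigenvalues only.  The value lam 0 is irrelevant. *)
definition ordered_eigenvalues_on ::
    "('k::{real_normed_field,banach} \<Rightarrow> 'a::real_inner \<Rightarrow> 'a) \<Rightarrow> 'a set \<Rightarrow> ('a \<Rightarrow> 'a) \<Rightarrow> (nat \<Rightarrow> real) \<Rightarrow> bool" where
  "ordered_eigenvalues_on sc X W lam \<longleftrightarrow>
     (\<forall>i\<ge>1. \<forall>j\<ge>i. lam j \<le> lam i) \<and> (\<forall>j\<ge>1. 0 \<le> lam j) \<and>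
     (\<forall>\<mu>>0. finite {j. 1 \<le> j \<and> lam j = \<mu>} \<and>
        card {j. 1 \<le> j \<and> lam j = \<mu>} = vector_space.dim sc {x \<in> X. W x = \<mu> *\<^sub>R x})"

definition algorithms ::
    "('k::{real_normed_field,banach} \<Rightarrow> 'a::real_inner \<Rightarrow> 'a) \<Rightarrow> ('k \<Rightarrow> 'b \<Rightarrow> 'b) \<Rightarrow>
     'a set \<Rightarrow> 'b::real_inner set \<Rightarrow> nat \<Rightarrow> ('a \<Rightarrow> 'b) set" where
  "algorithms scA scB X Y n =
     {A. \<exists>m\<le>n. \<exists>L g. (\<forall>i<m. linear_map_on scA (*) X (L i) \<and> continuous_on X (L i) \<and> g i \<in> Y) \<and>
           A = (\<lambda>f. \<Sum>i<m. scB (L i f) (g i))}"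

definition worst_case_error :: "'a::real_inner set \<Rightarrow> ('a \<Rightarrow> 'b::real_inner) \<Rightarrow> ('a \<Rightarrow> 'b) \<Rightarrow> real" where
  "worst_case_error X T A = (SUP f\<in>{f \<in> X. norm f \<le> 1}. norm (T f - A f))"

definition minimal_error ::
    "('k::{real_normed_field,banach} \<Rightarrow> 'a::real_inner \<Rightarrow> 'a) \<Rightarrow> ('k \<Rightarrow> 'b \<Rightarrow> 'b) \<Rightarrow>
     'a set \<Rightarrow> 'b::real_inner set \<Rightarrow> ('a \<Rightarrow> 'b) \<Rightarrow> nat \<Rightarrow> real" where
  "minimal_error scA scB X Y T n = (INF A\<in>algorithms scA scB X Y n. worst_case_error X T A)"

datatype criterion = Absolute | Normalized

definition information_complexity ::
    "('k::{real_normed_field,banach} \<Rightarrow> 'a::real_inner \<Rightarrow> 'a) \<Rightarrow> ('k \<Rightarrow> 'b \<Rightarrow> 'b) \<Rightarrow>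
     'a set \<Rightarrow> 'b::real_inner set \<Rightarrow> criterion \<Rightarrow> real \<Rightarrow> ('a \<Rightarrow> 'b) \<Rightarrow> nat" where
  "information_complexity scA scB X Y crit \<epsilon> T =
     (LEAST n. minimal_error scA scB X Y T n \<le>
        (case crit of Absolute \<Rightarrow> \<epsilon> | Normalized \<Rightarrow> \<epsilon> * minimal_error scA scB X Y T 0))"

definition weakly_tractable ::
    "('k::{real_normed_field,banach} \<Rightarrow> 'a::real_inner \<Rightarrow> 'a) \<Rightarrow> ('k \<Rightarrow> 'b \<Rightarrow> 'b) \<Rightarrow>
     (nat \<Rightarrow> 'a set) \<Rightarrow> (nat \<Rightarrow> 'b::real_inner set) \<Rightarrow> criterion \<Rightarrow> real \<Rightarrow> real \<Rightarrow>
     (nat \<Rightarrow> 'a \<Rightarrow> 'b) \<Rightarrow> bool" where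
  "weakly_tractable scA scB H G crit s t S \<longleftrightarrow>
     (\<forall>(\<epsilon> :: nat \<Rightarrow> real) (d :: nat \<Rightarrow> nat).
        (\<forall>k. 0 < \<epsilon> k \<and> \<epsilon> k \<le> 1 \<and> 1 \<le> d k \<and>
             \<epsilon> k < (case crit of Absolute \<Rightarrow> minimal_error scA scB (H (d k)) (G (d k)) (S (d k)) 0
                               | Normalized \<Rightarrow> 1)) \<and>
        filterlim (\<lambda>k. inverse (\<epsilon> k) + real (d k)) at_top sequentially \<longrightarrow>
        (\<lambda>k. ln (real (information_complexity scA scB (H (d k)) (G (d k)) crit (\<epsilon> k) (S (d k)))) /
             (\<epsilon> k powr (- s) + real (d k) powr t)) \<longlonglongrightarrow> 0)"

definition CRI :: "criterion \<Rightarrow> (nat \<Rightarrow> nat \<Rightarrow> real) \<Rightarrow> nat \<Rightarrow> real" where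
  "CRI crit lam d = (case crit of Absolute \<Rightarrow> 1 | Normalized \<Rightarrow> lam d 1)"

end

theory Submission
  imports Defs
begin

text \<open>
  The proof has two independent halves. The first identifies the minimal errors: with at most
  \<open>n\<close> functionals the best worst case error of a compact operator \<open>T\<close> equals the \<open>(n + 1)\<close>-st singular
  value, \<open>sqrt (lam (n + 1))\<close> (\<open>minimal_error_eq\<close>). No algorithm is better, because on the span of
  \<open>n + 1\<close> orthonormal eigenvectors of the leading eigenvalues \<open>T\<close> stretches every vector by at least
  that factor, and \<open>n\<close> linear functionals vanish at some nonzero vector of it. Conversely,
  \<open>T\<close> composed with the orthogonal projection onto the eigenspaces of all eigenvalues above
  \<open>lam (n + 1)\<close> attains the bound: on the orthogonal complement the quotient
  \<open>(norm (T x))\<^sup>2 / (norm x)\<^sup>2\<close>, unless it vanishes, attains its supremum at an eigenvector with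
  the supremum as eigenvalue (\<open>maximizer_is_eigenvector\<close>), so it cannot exceed \<open>lam (n + 1)\<close> there.

  The scalar field is an abstract complete normed field. It is never identified with the reals or
  the complex numbers: multiplication by a scalar of norm one is a surjective isometry, hence preserves
  the real inner product, and therefore the real orthogonal complement of a subspace over the
  scalars is again such a subspace. All orthogonality arguments rest on this.

  The second half is elementary analysis of the normalized eigenvalues
  \<open>\<mu> d j = lam d j / CRI crit lam d\<close>. By the first half, the information complexity is the least
  \<open>n\<close> with \<open>\<mu> d (n + 1) \<le> \<epsilon>\<^sup>2\<close>, so a bound \<open>ln n \<le> a * \<epsilon> powr - s\<close> on the complexity
  corresponds, up to a constant factor, to a bound \<open>\<mu> d n * ln n powr (2 / s) \<le> a powr (2 / s)\<close> on
  the spectrum.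
  Tractability is then a matter of balancing the two summands of \<open>\<epsilon> powr - s + d powr t\<close>: indices below
  \<open>exp (d powr t * sqrt \<beta>)\<close> are paid for by \<open>d powr t\<close>, the larger ones by \<open>\<epsilon> powr - s\<close>,
  and the finitely many dimensions below \<open>f \<beta>\<close> by the decay for each fixed dimension.
\<close>

section \<open>Minimization in complete subspaces\<close>

lemma linear_term_zero_if_quadratic_nonneg:
  fixes a b :: real
  assumes "\<And>r. 0 \<le> a * r\<^sup>2 + 2 * b * r"
  shows "b = 0"
proof (rule ccontr)
  assume "b \<noteq> 0"
  define k where "k = \<bar>a\<bar> + 1"
  have k: "k > 0" "a < k" "a - 2 * k < 0" by (auto simp: k_def)
  have "a * (- b / k)\<^sup>2 + 2 * b * (- b / k) = (a - 2 * k) * (b / k)\<^sup>2"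
    using k(1) by (simp add: field_simps power2_eq_square)
  also have "\<dots> < 0" using k \<open>b \<noteq> 0\<close> by (intro mult_neg_pos) auto
  finally show False using assms[of "- b / k"] by simp
qed

text \<open>
  The representing vector minimizes \<open>(norm x)\<^sup>2 - 2 * l x\<close>: the parallelogram law makes every
  minimizing sequence Cauchy, and the first variation at the minimum is the representation property.
  Besides adjoints this yields orthogonal projections, as the case \<open>l x = x \<bullet> a\<close> with \<open>a\<close> outside
  the subspace.
\<close>

lemma riesz_on_complete_subspace:
  fixes X :: "'a::real_inner set" and l :: "'a \<Rightarrow> real"
  assumes X: "subspace X" "complete X"
    and add: "\<And>x y. x \<in> X \<Longrightarrow> y \<in> X \<Longrightarrow> l (x + y) = l x + l y"
    and scale: "\<And>r x. x \<in> X \<Longrightarrow> l (r *\<^sub>R x) = r * l x"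
    and bound: "\<And>x. x \<in> X \<Longrightarrow> \<bar>l x\<bar> \<le> C * norm x"
  shows "\<exists>!z. z \<in> X \<and> (\<forall>x\<in>X. l x = x \<bullet> z)"
proof -
  define J where "J x = (norm x)\<^sup>2 - 2 * l x" for x
  define m where "m = Inf (J ` X)"
  have X0: "0 \<in> X" using X(1) by (rule subspace_0)
  have "- (C\<^sup>2) \<le> J x" if "x \<in> X" for x
  proof -
    have "0 \<le> (norm x - C)\<^sup>2" by simp
    then show ?thesis using bound[OF that] unfolding J_def power2_diff by (simp add: algebra_simps)
  qed
  then have bdd: "bdd_below (J ` X)" by (intro bdd_belowI2) auto
  then have mJ: "m \<le> J x" if "x \<in> X" for x unfolding m_def using that by (intro cINF_lower)
  have "\<exists>x. x \<in> X \<and> J x < m + inverse (real (Suc n))" for n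
  proof -
    have "Inf (J ` X) < m + inverse (real (Suc n))" unfolding m_def by simp
    then show ?thesis using cInf_lessD[of "J ` X"] X0 by blast
  qed
  then obtain u where u: "\<And>n. u n \<in> X" "\<And>n. J (u n) < m + inverse (real (Suc n))" by metis
  have l_diff: "l (x - y) = l x - l y" if "x \<in> X" "y \<in> X" for x y
    using add[of x "- 1 *\<^sub>R y"] scale[of y "- 1"] that X(1) by (simp add: subspace_neg)
  have para: "(norm (x - y))\<^sup>2 \<le> 2 * (J x - m) + 2 * (J y - m)" if "x \<in> X" "y \<in> X" for x y
  proof -
    have "m \<le> J ((1/2) *\<^sub>R (x + y))" using that X(1) by (intro mJ subspace_scale subspace_add)
    also have "\<dots> = (norm (x + y))\<^sup>2 / 4 - l x - l y"
      using that X(1) by (simp add: J_def scale add subspace_add power_divide del: scaleR_add_right)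
         (simp add: field_simps)
    finally have "4 * m \<le> (norm (x + y))\<^sup>2 - 4 * l x - 4 * l y" by simp
    moreover have "(norm (x - y))\<^sup>2 = 2 * (norm x)\<^sup>2 + 2 * (norm y)\<^sup>2 - (norm (x + y))\<^sup>2"
      by (simp add: power2_norm_eq_inner inner_simps inner_commute)
    ultimately show ?thesis by (simp add: J_def)
  qed
  have "Cauchy u"
  proof (rule metric_CauchyI)
    fix e :: real assume e: "e > 0"
    obtain N where N: "inverse (real (Suc N)) < e\<^sup>2 / 4" using reals_Archimedean[of "e\<^sup>2 / 4"] e by auto
    have "dist (u i) (u j) < e" if "i \<ge> N" "j \<ge> N" for i j
    proof -
      have near: "J (u k) - m < e\<^sup>2 / 4" if "k \<ge> N" for k
      proof -
        have "inverse (real (Suc k)) \<le> inverse (real (Suc N))"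
          using that by (intro le_imp_inverse_le) auto
        then show ?thesis using u(2)[of k] N by argo
      qed
      have "(norm (u i - u j))\<^sup>2 < e\<^sup>2"
        using para[OF u(1) u(1), of i j] near[OF that(1)] near[OF that(2)] by argo
      then show ?thesis using e by (simp add: dist_norm power_less_imp_less_base)
    qed
    then show "\<exists>N. \<forall>i\<ge>N. \<forall>j\<ge>N. dist (u i) (u j) < e" by blast
  qed
  then obtain z where z: "z \<in> X" "u \<longlonglongrightarrow> z" using X(2) u(1) unfolding complete_def by blast
  have "(\<lambda>n. l (u n)) \<longlonglongrightarrow> l z"
  proof (rule LIM_zero_cancel, rule Lim_null_comparison)
    show "\<forall>\<^sub>F n in sequentially. norm (l (u n) - l z) \<le> C * norm (u n - z)"
      using bound[OF subspace_diff[OF X(1) u(1) z(1)]] l_diff[OF u(1) z(1)] by (auto intro!: always_eventually)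
    show "(\<lambda>n. C * norm (u n - z)) \<longlonglongrightarrow> 0"
      using z(2) by (intro tendsto_mult_right_zero tendsto_norm_zero) (simp add: LIM_zero_iff)
  qed
  then have "(\<lambda>n. J (u n)) \<longlonglongrightarrow> J z" unfolding J_def using z(2) by (intro tendsto_intros)
  moreover have "(\<lambda>n. m + inverse (real (Suc n))) \<longlonglongrightarrow> m + 0"
    by (intro tendsto_intros LIMSEQ_inverse_real_of_nat)
  ultimately have "J z \<le> m + 0" by (rule LIMSEQ_le) (use u(2) less_imp_le in blast)
  then have Jz: "J z \<le> J x" if "x \<in> X" for x using mJ[OF that] by simp
  have rep: "l x = x \<bullet> z" if x: "x \<in> X" for x
  proof -
    have "0 \<le> (norm x)\<^sup>2 * r\<^sup>2 + 2 * (x \<bullet> z - l x) * r" for r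
    proof -
      have "J z \<le> J (z + r *\<^sub>R x)" using x z(1) X(1) by (intro Jz subspace_add subspace_scale)
      also have "\<dots> = J z + ((norm x)\<^sup>2 * r\<^sup>2 + 2 * (x \<bullet> z - l x) * r)"
        using x z(1) X(1) unfolding J_def
        by (simp add: add scale subspace_scale power2_norm_eq_inner inner_simps inner_commute)
           (simp add: power2_eq_square algebra_simps)
      finally show ?thesis by simp
    qed
    then show ?thesis using linear_term_zero_if_quadratic_nonneg by fastforce
  qed
  show ?thesis
  proof (intro ex1I[of _ z] conjI ballI)
    fix z' assume z': "z' \<in> X \<and> (\<forall>x\<in>X. l x = x \<bullet> z')"
    then have "(z' - z) \<bullet> (z' - z) = 0"
      using rep subspace_diff[OF X(1), of z' z] z(1) by (simp add: inner_diff_right)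
    then show "z' = z" by simp
  qed (use z rep in auto)
qed

section \<open>Orthogonality over the scalar field\<close>

context hilbert_scalars
begin

text \<open>
  Polarization of the norm identity. It replaces the sesquilinearity of an inner product with
  values in the scalar field.
\<close>

lemma inner_sc_sc: "sc c x \<bullet> sc c y = (norm c)\<^sup>2 * (x \<bullet> y)"
proof -
  have "sc c x \<bullet> sc c y = ((norm (sc c (x + y)))\<^sup>2 - (norm (sc c x))\<^sup>2 - (norm (sc c y))\<^sup>2) / 2"
    by (simp add: scale_right_distrib dot_norm)
  also have "\<dots> = (norm c)\<^sup>2 * (x \<bullet> y)"
    unfolding norm_sc power_mult_distrib by (simp add: dot_norm algebra_simps)
  finally show ?thesis .
qed

lemma inner_sc_left:
  assumes "c \<noteq> 0"
  shows "sc c x \<bullet> y = (norm c)\<^sup>2 * (x \<bullet> sc (inverse c) y)"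
  using inner_sc_sc[of c x "sc (inverse c) y"] assms by simp

lemma subspace_imp_real_subspace:
  assumes "module.subspace sc X"
  shows "real_vector.subspace X"
  using assms sc_of_real unfolding subspace_def real_vector.subspace_def by metis

text \<open>
  For complex scalars this says that the complex inner product vanishes; the real inner product
  alone only controls its real part.
\<close>

definition orth :: "'a \<Rightarrow> 'a \<Rightarrow> bool" where
  "orth x y \<longleftrightarrow> (\<forall>c. sc c x \<bullet> y = 0)"

definition orthonormal :: "'a set \<Rightarrow> bool" where
  "orthonormal B \<longleftrightarrow> (\<forall>b\<in>B. norm b = 1) \<and> pairwise orth B"

text \<open>
  For a unit vector \<open>b\<close> this is the scalar-valued inner product of \<open>x\<close> with \<open>b\<close>.
\<close>

definition coef :: "'a \<Rightarrow> 'a \<Rightarrow> 'k" where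
  "coef b x = (THE c. orth b (x - sc c b))"

definition proj :: "'a set \<Rightarrow> 'a \<Rightarrow> 'a" where
  "proj B x = (\<Sum>b\<in>B. sc (coef b x) b)"

lemma orth_sc_sc:
  assumes "orth x y"
  shows "sc c x \<bullet> sc e y = 0"
proof (cases "e = 0")
  case False
  then have "sc e y \<bullet> sc c x = (norm e)\<^sup>2 * (y \<bullet> sc (inverse e) (sc c x))" by (rule inner_sc_left)
  also have "y \<bullet> sc (inverse e) (sc c x) = 0" using assms by (simp add: orth_def inner_commute)
  finally show ?thesis by (simp add: inner_commute)
qed simp

lemma orth_sym: "orth x y \<Longrightarrow> orth y x"
  using orth_sc_sc[of x y 1] by (simp add: orth_def inner_commute)

lemma orth_sc_right: "orth x y \<Longrightarrow> orth x (sc c y)"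
  by (simp add: orth_sc_sc orth_def[of x "sc c y"])

lemma orth_add_right: "orth x y \<Longrightarrow> orth x z \<Longrightarrow> orth x (y + z)"
  by (simp add: orth_def inner_add_right)

lemma orth_sum_right: "(\<And>i. i \<in> I \<Longrightarrow> orth x (f i)) \<Longrightarrow> orth x (sum f I)"
  by (simp add: orth_def inner_sum_right)

lemma orth_inner: "orth x y \<Longrightarrow> x \<bullet> y = 0"
  using orth_sc_sc[of x y 1 1] by simp

text \<open>
  The line through \<open>b\<close> is an isometric copy of the complete scalar field, so the real orthogonal
  projection onto it exists.
\<close>

lemma coef_ex1:
  assumes b: "norm b = 1"
  shows "\<exists>!c. orth b (x - sc c b)"
proof -
  let ?K = "range (\<lambda>c. sc c b)"
  have sub: "real_vector.subspace ?K"
  proof (rule subspace_imp_real_subspace)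
    show "local.subspace ?K"
      unfolding subspace_def
    proof (intro conjI ballI allI)
      show "0 \<in> ?K" using scale_zero_left by (metis rangeI)
      show "x + y \<in> ?K" if "x \<in> ?K" "y \<in> ?K" for x y
        using that by (auto simp flip: scale_left_distrib)
      show "sc c x \<in> ?K" if "x \<in> ?K" for c x
        using that by auto
    qed
  qed
  have com: "complete ?K"
    unfolding complete_def
  proof safe
    fix f assume f: "\<forall>n. f n \<in> ?K" "Cauchy f"
    from f(1) have "\<forall>n. \<exists>c. f n = sc c b" by auto
    then obtain c where c: "\<And>n. f n = sc (c n) b" by metis
    have d: "dist (sc u b) (sc v b) = dist u v" for u v
    proof -
      have "sc u b - sc v b = sc (u - v) b" by (rule scale_left_diff_distrib[symmetric])
      then show ?thesis by (simp only: dist_norm norm_sc b mult_1_right)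
    qed
    have "Cauchy c" using f(2) unfolding Cauchy_def c d .
    then obtain e where "c \<longlonglongrightarrow> e" using Cauchy_convergent convergent_def by blast
    then have "f \<longlonglongrightarrow> sc e b" unfolding tendsto_iff c d .
    then show "\<exists>l\<in>?K. f \<longlonglongrightarrow> l" by blast
  qed
  have ex: "\<exists>!z. z \<in> ?K \<and> (\<forall>y\<in>?K. y \<bullet> x = y \<bullet> z)"
    by (rule riesz_on_complete_subspace[OF sub com, where C = "norm x"])
       (auto simp: inner_add_left mult.commute Cauchy_Schwarz_ineq2)
  then obtain c where c: "\<And>y. y \<in> ?K \<Longrightarrow> y \<bullet> x = y \<bullet> sc c b" by blast
  show ?thesis
  proof (rule ex1I)
    show "orth b (x - sc c b)" using c[OF rangeI] by (simp add: orth_def inner_diff_right)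
    fix e assume "orth b (x - sc e b)"
    then have "\<forall>y\<in>?K. y \<bullet> x = y \<bullet> sc e b" by (auto simp: orth_def inner_diff_right)
    then have "sc e b = sc c b" using ex c by blast
    then show "e = c" using b by (auto simp: scale_cancel_right)
  qed
qed

lemma orth_coef: "norm b = 1 \<Longrightarrow> orth b (x - sc (coef b x) b)"
  unfolding coef_def by (rule theI'[OF coef_ex1])

lemma coef_eqI: "norm b = 1 \<Longrightarrow> orth b (x - sc c b) \<Longrightarrow> coef b x = c"
  unfolding coef_def by (rule the1_equality[OF coef_ex1])

lemma coef_add:
  assumes b: "norm b = 1"
  shows "coef b (x + y) = coef b x + coef b y"
proof (rule coef_eqI[OF b])
  have eq: "x + y - sc (coef b x + coef b y) b = (x - sc (coef b x) b) + (y - sc (coef b y) b)"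
    unfolding scale_left_distrib by simp
  show "orth b (x + y - sc (coef b x + coef b y) b)"
    unfolding eq by (intro orth_add_right orth_coef b)
qed

lemma coef_sc:
  assumes b: "norm b = 1"
  shows "coef b (sc c x) = c * coef b x"
proof (rule coef_eqI[OF b])
  have eq: "sc c x - sc (c * coef b x) b = sc c (x - sc (coef b x) b)"
    unfolding scale_right_diff_distrib scale_scale ..
  show "orth b (sc c x - sc (c * coef b x) b)"
    unfolding eq by (intro orth_sc_right orth_coef b)
qed

lemma norm_coef_le:
  assumes b: "norm b = 1"
  shows "norm (coef b x) \<le> norm x"
proof (cases "coef b x = 0")
  case False
  let ?p = "sc (coef b x) b"
  have n: "norm ?p = norm (coef b x)" by (simp only: norm_sc b mult_1_right)
  have "?p \<bullet> (x - ?p) = 0" using orth_coef[OF b] unfolding orth_def by blast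
  then have "?p \<bullet> ?p = ?p \<bullet> x" by (simp only: inner_diff_right right_minus_eq)
  then have "norm (coef b x) * norm (coef b x) \<le> norm (coef b x) * norm x"
    using norm_cauchy_schwarz[of ?p x] unfolding n norm_eq_sqrt_inner[of ?p, symmetric]
    by (metis n power2_eq_square power2_norm_eq_inner)
  then show ?thesis using False by (simp only: mult_le_cancel_left_pos zero_less_norm_iff simp_thms not_False_eq_True)
qed simp

lemma continuous_on_coef:
  assumes b: "norm b = 1"
  shows "continuous_on A (coef b)"
proof -
  have d: "dist (coef b x) (coef b y) \<le> dist x y" for x y
    using coef_add[OF b, of "x - y" y] norm_coef_le[OF b, of "x - y"] by (simp add: dist_norm)
  then show ?thesis
    unfolding continuous_on_iff by (meson order_le_less_trans)
qed

lemma orth_residual: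
  assumes B: "finite B" "orthonormal B" and b: "b \<in> B"
  shows "orth b (x - proj B x)"
proof -
  have eq: "x - proj B x = (x - sc (coef b x) b) + sc (- 1) (\<Sum>b'\<in>B - {b}. sc (coef b' x) b')"
    unfolding proj_def sum.remove[OF B(1) b] by simp
  have "orth b (x - sc (coef b x) b)"
    using B b by (intro orth_coef) (auto simp: orthonormal_def)
  moreover have "orth b (sc (- 1) (\<Sum>b'\<in>B - {b}. sc (coef b' x) b'))"
    using B b by (intro orth_sc_right orth_sum_right) (auto simp: orthonormal_def pairwise_def)
  ultimately show ?thesis unfolding eq by (rule orth_add_right)
qed

lemma norm_residual_le:
  assumes B: "finite B" "orthonormal B"
  shows "norm (x - proj B x) \<le> norm x"
proof -
  have "orth (x - proj B x) (sc (coef b x) b)" if "b \<in> B" for b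
    using orth_sym[OF orth_residual[OF B that]] by (rule orth_sc_right)
  then have "orth (x - proj B x) (proj B x)" unfolding proj_def[of B x] by (rule orth_sum_right)
  then have 0: "(x - proj B x) \<bullet> proj B x = 0" by (rule orth_inner)
  define r where "r = x - proj B x"
  have "(norm x)\<^sup>2 = (norm (r + proj B x))\<^sup>2" by (simp add: r_def)
  also have "\<dots> = (norm r)\<^sup>2 + (norm (proj B x))\<^sup>2"
    using 0 unfolding r_def[symmetric] by (intro norm_add_Pythagorean) (simp add: orthogonal_def)
  finally have "(norm r)\<^sup>2 \<le> (norm x)\<^sup>2" by simp
  then show ?thesis unfolding r_def by (rule power2_le_imp_le) simp
qed

lemma norm_sum_orth:
  assumes "finite B" "pairwise (\<lambda>b b'. orth (f b) (f b')) B"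
  shows "(norm (\<Sum>b\<in>B. sc (c b) (f b)))\<^sup>2 = (\<Sum>b\<in>B. (norm (c b))\<^sup>2 * (norm (f b))\<^sup>2)"
proof -
  have "(norm (\<Sum>b\<in>B. sc (c b) (f b)))\<^sup>2 = (\<Sum>b\<in>B. (norm (sc (c b) (f b)))\<^sup>2)"
    using assms by (intro norm_sum_Pythagorean) (auto simp: pairwise_def orthogonal_def orth_sc_sc)
  then show ?thesis by (simp add: norm_sc power_mult_distrib)
qed

text \<open>
  Links orthonormal systems to dimensions, in terms of which eigenvalue multiplicities are counted.
\<close>

lemma orthonormal_independent:
  assumes B: "finite B" "orthonormal B"
  shows "\<not> local.dependent B"
proof (rule independent_if_scalars_zero[OF B(1)])
  fix f x assume 0: "(\<Sum>x\<in>B. sc (f x) x) = 0" and x: "x \<in> B"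
  have "(\<Sum>b\<in>B. (norm (f b))\<^sup>2 * (norm b)\<^sup>2) = 0"
    using norm_sum_orth[OF B(1), of "\<lambda>x. x" f] B(2) 0 by (auto simp: orthonormal_def)
  then have "(norm (f x))\<^sup>2 * (norm x)\<^sup>2 = 0" using B(1) x by (subst (asm) sum_nonneg_eq_0_iff) auto
  then show "f x = 0" using B(2) x by (auto simp: orthonormal_def)
qed

end


section \<open>Eigenspaces of a compact operator\<close>

text \<open>
  Gaussian elimination: the pivot \<open>p\<close> removes one unknown together with the last equation.
\<close>

lemma underdetermined_system_solution:
  fixes a :: "nat \<Rightarrow> 'b \<Rightarrow> 'k::field"
  assumes "finite B" "m < card B"
  shows "\<exists>c. (\<exists>b\<in>B. c b \<noteq> 0) \<and> (\<forall>i<m. (\<Sum>b\<in>B. a i b * c b) = 0)"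
  using assms
proof (induction m arbitrary: a B)
  case 0
  then obtain b where "b \<in> B" by fastforce
  then show ?case by (intro exI[of _ "\<lambda>_. 1"]) auto
next
  case (Suc m)
  show ?case
  proof (cases "\<forall>b\<in>B. a m b = 0")
    case True
    obtain c where "\<exists>b\<in>B. c b \<noteq> 0" "\<forall>i<m. (\<Sum>b\<in>B. a i b * c b) = 0"
      using Suc.IH[of B a] Suc.prems by auto
    then show ?thesis using True by (intro exI[of _ c]) (auto simp: less_Suc_eq)
  next
    case False
    then obtain p where p: "p \<in> B" "a m p \<noteq> 0" by blast
    let ?B = "B - {p}"
    have "m < card ?B" using p(1) Suc.prems by (simp add: card_Diff_singleton)
    then obtain c where c: "\<exists>b\<in>?B. c b \<noteq> 0"
      "\<And>i. i < m \<Longrightarrow> (\<Sum>b\<in>?B. (a i b - a i p * a m b / a m p) * c b) = 0"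
      using Suc.IH[of ?B "\<lambda>i b. a i b - a i p * a m b / a m p"] Suc.prems(1) by blast
    define q where "q = - (\<Sum>b\<in>?B. a m b * c b) / a m p"
    define c' where "c' = c(p := q)"
    have sum: "(\<Sum>b\<in>B. a i b * c' b) = a i p * q + (\<Sum>b\<in>?B. a i b * c b)" for i
      using Suc.prems(1) p(1) by (simp add: sum.remove[of B p] c'_def)
    have "(\<Sum>b\<in>B. a i b * c' b) = 0" if "i < Suc m" for i
    proof (cases "i = m")
      case True
      then show ?thesis using p(2) by (simp add: sum q_def)
    next
      case False
      then have "i < m" using that by simp
      from c(2)[OF this] have "(\<Sum>b\<in>?B. a i b * c b) = (\<Sum>b\<in>?B. a i p * a m b / a m p * c b)"
        by (simp only: left_diff_distrib sum_subtractf right_minus_eq)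
      also have "\<dots> = a i p * (\<Sum>b\<in>?B. a m b * c b) / a m p"
        by (simp add: sum_distrib_left sum_divide_distrib mult_ac)
      finally have "(\<Sum>b\<in>?B. a i b * c b) = a i p * (\<Sum>b\<in>?B. a m b * c b) / a m p" .
      then show ?thesis by (simp add: sum q_def)
    qed
    then show ?thesis using c(1) by (intro exI[of _ c']) (auto simp: c'_def)
  qed
qed

locale hilbert_compact_operator =
  A: hilbert_scalars scA + B: hilbert_scalars scB
  for scA :: "'k::{real_normed_field,banach} \<Rightarrow> 'h::real_inner \<Rightarrow> 'h"
    and scB :: "'k \<Rightarrow> 'g::real_inner \<Rightarrow> 'g" +
  fixes X :: "'h set" and Y :: "'g set" and T :: "'h \<Rightarrow> 'g"
  assumes hilbert_X: "hilbert_space_on scA X"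
    and compact_T: "compact_operator_on scA scB X Y T"
begin

lemma sub_X: "A.subspace X" and com_X: "complete X"
  using hilbert_X by (auto simp: hilbert_space_on_def)

lemma rsub_X: "real_vector.subspace X"
  by (rule A.subspace_imp_real_subspace[OF sub_X])

lemmas X_intros = A.subspace_0[OF sub_X] A.subspace_add[OF sub_X] A.subspace_diff[OF sub_X]
  A.subspace_scale[OF sub_X] real_vector.subspace_scale[OF rsub_X]

lemma T_add: "x \<in> X \<Longrightarrow> y \<in> X \<Longrightarrow> T (x + y) = T x + T y"
  and T_sc: "x \<in> X \<Longrightarrow> T (scA c x) = scB c (T x)"
  and T_Y: "x \<in> X \<Longrightarrow> T x \<in> Y"
  and compact_ball: "compact (closure (T ` {x \<in> X. norm x \<le> 1}))"
  using compact_T by (auto simp: compact_operator_on_def linear_map_on_def)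

lemma T_scaleR: "x \<in> X \<Longrightarrow> T (r *\<^sub>R x) = r *\<^sub>R T x"
  using T_sc[of x "of_real r"] by (simp add: A.sc_of_real B.sc_of_real)

lemma T_diff: "x \<in> X \<Longrightarrow> y \<in> X \<Longrightarrow> T (x - y) = T x - T y"
  using T_add[of x "- 1 *\<^sub>R y"] T_scaleR[of y "- 1"] X_intros(5)[of y "-1"] by simp

lemma T_0 [simp]: "T 0 = 0"
  using T_scaleR[of 0 0] X_intros(1) by simp

lemma T_sum: "(\<And>i. i \<in> I \<Longrightarrow> f i \<in> X) \<Longrightarrow> T (\<Sum>i\<in>I. f i) = (\<Sum>i\<in>I. T (f i))"
proof (induction I rule: infinite_finite_induct)
  case (insert i I)
  then show ?case using A.subspace_sum[OF sub_X, of I f] by (simp add: T_add)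
qed auto

lemma sum_sc_in_X: "B \<subseteq> X \<Longrightarrow> (\<Sum>b\<in>B. scA (c b) b) \<in> X"
  using X_intros(4) by (intro A.subspace_sum[OF sub_X]) auto

lemma T_sum_sc: "B \<subseteq> X \<Longrightarrow> T (\<Sum>b\<in>B. scA (c b) b) = (\<Sum>b\<in>B. scB (c b) (T b))"
  using X_intros(4) by (subst T_sum) (auto simp: T_sc intro!: sum.cong)

lemma T_bounded: obtains C where "C > 0" "\<And>x. x \<in> X \<Longrightarrow> norm (T x) \<le> C * norm x"
proof -
  have "bounded (T ` {x \<in> X. norm x \<le> 1})"
    using compact_imp_bounded[OF compact_ball] bounded_subset closure_subset by blast
  then obtain C where C: "C > 0" "\<And>x. x \<in> X \<Longrightarrow> norm x \<le> 1 \<Longrightarrow> norm (T x) \<le> C"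
    unfolding bounded_pos by blast
  have "norm (T x) \<le> C * norm x" if x: "x \<in> X" for x
  proof (cases "x = 0")
    case False
    have "norm (T (inverse (norm x) *\<^sub>R x)) \<le> C" using x False by (intro C X_intros) auto
    then show ?thesis using x False by (simp add: T_scaleR field_simps)
  qed simp
  with C(1) that show thesis by blast
qed

text \<open>
  The weak form of \<open>T\<^sup>* (T x) = \<mu> x\<close>, which avoids the adjoint in all later computations.
\<close>

definition eigenspace :: "real \<Rightarrow> 'h set" where
  "eigenspace \<mu> = {x \<in> X. \<forall>y\<in>X. T x \<bullet> T y = \<mu> * (x \<bullet> y)}"

lemma eigenspace_eq: "eigenspace \<mu> = {x \<in> X. (adjoint_on X T \<circ> T) x = \<mu> *\<^sub>R x}"
proof -
  obtain C where C: "\<And>x. x \<in> X \<Longrightarrow> norm (T x) \<le> C * norm x" using T_bounded by metis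
  have "(\<forall>y\<in>X. T x \<bullet> T y = \<mu> * (x \<bullet> y)) \<longleftrightarrow> adjoint_on X T (T x) = \<mu> *\<^sub>R x" if x: "x \<in> X" for x
  proof -
    have ex: "\<exists>!z. z \<in> X \<and> (\<forall>y\<in>X. T y \<bullet> T x = y \<bullet> z)"
    proof (rule riesz_on_complete_subspace[OF rsub_X com_X, where C = "C * norm (T x)"])
      fix y assume "y \<in> X"
      have "\<bar>T y \<bullet> T x\<bar> \<le> norm (T y) * norm (T x)" by (rule Cauchy_Schwarz_ineq2)
      also have "\<dots> \<le> C * norm y * norm (T x)" using C[OF \<open>y \<in> X\<close>] by (intro mult_right_mono) auto
      finally show "\<bar>T y \<bullet> T x\<bar> \<le> C * norm (T x) * norm y" by (simp add: mult_ac)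
    qed (auto simp: T_add T_scaleR inner_add_left)
    have mx: "\<mu> *\<^sub>R x \<in> X" using x by (rule X_intros)
    have "(\<forall>y\<in>X. T x \<bullet> T y = \<mu> * (x \<bullet> y)) \<longleftrightarrow> (\<forall>y\<in>X. T y \<bullet> T x = y \<bullet> (\<mu> *\<^sub>R x))"
      by (simp add: inner_commute)
    also have "\<dots> \<longleftrightarrow> adjoint_on X T (T x) = \<mu> *\<^sub>R x"
    proof
      assume "\<forall>y\<in>X. T y \<bullet> T x = y \<bullet> (\<mu> *\<^sub>R x)"
      with mx show "adjoint_on X T (T x) = \<mu> *\<^sub>R x"
        unfolding adjoint_on_def by (intro the1_equality[OF ex] conjI)
    next
      assume "adjoint_on X T (T x) = \<mu> *\<^sub>R x"
      with theI'[OF ex] show "\<forall>y\<in>X. T y \<bullet> T x = y \<bullet> (\<mu> *\<^sub>R x)"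
        unfolding adjoint_on_def by simp
    qed
    finally show ?thesis .
  qed
  then show ?thesis by (auto simp: eigenspace_def)
qed

lemma eigenspace_X: "x \<in> eigenspace \<mu> \<Longrightarrow> x \<in> X"
  by (simp add: eigenspace_def)

lemma eigenspace_inner: "x \<in> eigenspace \<mu> \<Longrightarrow> y \<in> X \<Longrightarrow> T x \<bullet> T y = \<mu> * (x \<bullet> y)"
  by (simp add: eigenspace_def)

lemma subspace_eigenspace: "A.subspace (eigenspace \<mu>)"
proof -
  have "scA c x \<in> eigenspace \<mu>" if x: "x \<in> eigenspace \<mu>" for c x
  proof (cases "c = 0")
    case False
    have "T (scA c x) \<bullet> T y = \<mu> * (scA c x \<bullet> y)" if y: "y \<in> X" for y
    proof -
      have "T (scA c x) \<bullet> T y = (norm c)\<^sup>2 * (T x \<bullet> T (scA (inverse c) y))"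
        using x y False by (simp add: eigenspace_X T_sc B.inner_sc_left)
      also have "\<dots> = \<mu> * (scA c x \<bullet> y)"
        using x y False by (simp add: eigenspace_inner X_intros A.inner_sc_left)
      finally show ?thesis .
    qed
    then show ?thesis using x by (simp add: eigenspace_def X_intros)
  qed (use X_intros(1) in \<open>simp add: eigenspace_def\<close>)
  then show ?thesis
    unfolding A.subspace_def by (auto simp: eigenspace_def X_intros T_add inner_add_left algebra_simps)
qed

lemma eigenspaces_orth:
  assumes x: "x \<in> eigenspace \<mu>" and y: "y \<in> eigenspace \<nu>" and ne: "\<mu> \<noteq> \<nu>"
  shows "A.orth x y"
  unfolding A.orth_def
proof
  fix c
  have cx: "scA c x \<in> eigenspace \<mu>" using x subspace_eigenspace A.subspace_scale by blast
  have "\<mu> * (scA c x \<bullet> y) = \<nu> * (scA c x \<bullet> y)"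
    using eigenspace_inner[OF cx eigenspace_X[OF y]] eigenspace_inner[OF y eigenspace_X[OF cx]]
    unfolding inner_commute[of "T y"] inner_commute[of y] by (simp only:)
  then show "scA c x \<bullet> y = 0" using ne by simp
qed

lemma orth_image_of_eigenvector:
  assumes "y \<in> eigenspace \<nu>" "x \<in> X" "A.orth x y"
  shows "B.orth (T x) (T y)"
  unfolding B.orth_def
proof
  fix c
  have "T (scA c x) \<bullet> T y = \<nu> * (scA c x \<bullet> y)"
    using eigenspace_inner[OF assms(1), of "scA c x"] assms(2) by (simp add: X_intros inner_commute)
  then show "scB c (T x) \<bullet> T y = 0" using assms(2,3) by (simp add: T_sc A.orth_def)
qed

lemma norm_image_eigenvector: "x \<in> eigenspace \<mu> \<Longrightarrow> (norm (T x))\<^sup>2 = \<mu> * (norm x)\<^sup>2"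
  by (simp add: power2_norm_eq_inner eigenspace_inner eigenspace_X)

text \<open>
  Images of distinct members of such a system are at distance at least \<open>sqrt (2 * c)\<close>, so a cover of
  the totally bounded image of the unit ball by balls with half that distance as radius has at least
  as many balls as the system has members. This is what forces the positive multiplicities to be finite and the
  eigenvalues to tend to zero.
\<close>

lemma card_large_eigensystem_bounded:
  assumes "c > 0"
  shows "\<exists>N. \<forall>B. finite B \<and> A.orthonormal B \<and> (\<forall>b\<in>B. \<exists>\<mu>\<ge>c. b \<in> eigenspace \<mu>) \<longrightarrow> card B \<le> N"
proof -
  define e where "e = sqrt (2 * c) / 2"
  have e: "e > 0" using assms by (simp add: e_def)
  then obtain K where K: "finite K" "closure (T ` {x \<in> X. norm x \<le> 1}) \<subseteq> (\<Union>k\<in>K. ball k e)"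
    using compact_ball unfolding compact_eq_totally_bounded by blast
  have "card B \<le> card K"
    if B: "finite B" "A.orthonormal B" "\<forall>b\<in>B. \<exists>\<mu>\<ge>c. b \<in> eigenspace \<mu>" for B
  proof -
    have "\<exists>k\<in>K. dist k (T b) < e" if "b \<in> B" for b
    proof -
      have "T b \<in> closure (T ` {x \<in> X. norm x \<le> 1})"
        using B that closure_subset eigenspace_X by (fastforce simp: A.orthonormal_def)
      then obtain k where "k \<in> K" "T b \<in> ball k e" using K(2) by blast
      then show ?thesis by (auto simp: dist_commute)
    qed
    then obtain g where g: "\<And>b. b \<in> B \<Longrightarrow> g b \<in> K" "\<And>b. b \<in> B \<Longrightarrow> dist (g b) (T b) < e" by metis
    have "inj_on g B"
    proof (rule inj_onI, rule ccontr)
      fix x y assume xy: "x \<in> B" "y \<in> B" "g x = g y" "x \<noteq> y"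
      have n: "norm x = 1" "norm y = 1" "A.orth x y"
        using B(2) xy by (auto simp: A.orthonormal_def pairwise_def)
      obtain \<mu> \<nu> where ev: "\<mu> \<ge> c" "x \<in> eigenspace \<mu>" "\<nu> \<ge> c" "y \<in> eigenspace \<nu>"
        using B(3) xy by meson
      have "T x \<bullet> T y = 0"
        using orth_image_of_eigenvector[OF ev(4) eigenspace_X[OF ev(2)] n(3)] by (rule B.orth_inner)
      then have "(dist (T x) (T y))\<^sup>2 = (norm (T x))\<^sup>2 + (norm (T y))\<^sup>2"
        by (simp add: dist_norm power2_norm_eq_inner inner_simps inner_commute)
      also have "\<dots> = \<mu> + \<nu>" using ev n by (simp add: norm_image_eigenvector)
      finally have "2 * c \<le> (dist (T x) (T y))\<^sup>2" using ev by simp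
      then have "sqrt (2 * c) \<le> dist (T x) (T y)" by (intro real_le_lsqrt) auto
      moreover have "dist (T x) (T y) < e + e"
        using g(2)[OF xy(1)] g(2)[OF xy(2)] xy(3) dist_triangle3[of "T x" "T y" "g x"] by simp
      ultimately show False by (simp add: e_def)
    qed
    then show ?thesis using g(1) K(1) by (intro card_inj_on_le[of g]) auto
  qed
  then show ?thesis by blast
qed

text \<open>
  An orthonormal system of maximal cardinality spans: otherwise a normalized projection residual
  would extend it. In particular the dimension is genuine: \<open>dim\<close> is \<open>0\<close> by convention for
  infinite-dimensional spaces, and the finite spanning set excludes that case.
\<close>

lemma eigenspace_orthonormal_basis:
  assumes "\<mu> > 0"
  shows "\<exists>B. finite B \<and> A.orthonormal B \<and> B \<subseteq> eigenspace \<mu> \<and> eigenspace \<mu> \<subseteq> A.span B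
    \<and> card B = A.dim (eigenspace \<mu>)"
proof -
  let ?P = "\<lambda>B. finite B \<and> A.orthonormal B \<and> B \<subseteq> eigenspace \<mu>"
  obtain N where N: "\<And>B. ?P B \<Longrightarrow> card B \<le> N"
    using card_large_eigensystem_bounded[OF assms] by (meson order_refl subsetD)
  have "\<exists>B. ?P B \<and> (\<forall>B'. ?P B' \<longrightarrow> card B' \<le> card B)"
  proof (rule ex_has_greatest_nat)
    show "?P {}" by (simp add: A.orthonormal_def)
    show "\<forall>B. ?P B \<longrightarrow> card B < Suc N" using N by (simp only: less_Suc_eq_le) blast
  qed
  then obtain B where B: "?P B" and max: "\<And>B'. ?P B' \<Longrightarrow> card B' \<le> card B" by blast
  have proj: "A.proj B x \<in> A.span B" for x
    unfolding A.proj_def by (intro A.span_sum A.span_scale A.span_base)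
  have "x \<in> A.span B" if x: "x \<in> eigenspace \<mu>" for x
  proof (rule ccontr)
    assume nx: "x \<notin> A.span B"
    define r where "r = x - A.proj B x"
    define u where "u = inverse (norm r) *\<^sub>R r"
    have "r \<noteq> 0" using nx proj[of x] by (auto simp: r_def)
    have "A.proj B x \<in> eigenspace \<mu>"
      using proj[of x] B A.span_minimal[OF _ subspace_eigenspace] by blast
    then have r: "r \<in> eigenspace \<mu>" unfolding r_def using x subspace_eigenspace A.subspace_diff by blast
    have u: "u = scA (of_real (inverse (norm r))) r" by (simp only: u_def A.sc_of_real)
    then have "u \<in> eigenspace \<mu>" using r subspace_eigenspace A.subspace_scale by blast
    moreover have "norm u = 1" using \<open>r \<noteq> 0\<close> by (simp add: u_def)
    moreover have o: "A.orth b u" if "b \<in> B" for b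
      unfolding u r_def using A.orth_residual B that by (intro A.orth_sc_right) auto
    ultimately have "?P (insert u B)"
      using B by (auto simp: A.orthonormal_def pairwise_insert intro: A.orth_sym)
    from max[OF this] have "u \<in> B" using B by (auto simp: card_insert_if split: if_splits)
    then have "u \<bullet> u = 0" using o A.orth_inner by blast
    then show False using \<open>norm u = 1\<close> by simp
  qed
  then have sub: "eigenspace \<mu> \<subseteq> A.span B" by blast
  moreover have "A.dim (eigenspace \<mu>) = card B"
    using A.basis_card_eq_dim[of B "eigenspace \<mu>"] B sub A.orthonormal_independent by auto
  ultimately show ?thesis using B by auto
qed

text \<open>
  Let \<open>M\<close> be the supremum of \<open>(norm (T x))\<^sup>2\<close> over the unit ball of \<open>V\<close>. Along a maximizing sequence
  with convergent images, \<open>norm (T (w i + w j))\<close> approaches \<open>2 * sqrt M\<close>, hence \<open>norm (w i + w j)\<close>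
  approaches its largest possible value \<open>2\<close>, and the parallelogram law shows that the sequence
  itself is Cauchy. Thus the supremum is attained in norm, and the first
  variation at the maximizer is the eigenvector equation tested against \<open>V\<close>.
\<close>

lemma maximizer_is_eigenvector:
  assumes V: "real_vector.subspace V" "complete V" "V \<subseteq> X"
    and y: "y \<in> V" "(norm (T y))\<^sup>2 > c * (norm y)\<^sup>2" and c: "c \<ge> 0"
  shows "\<exists>M>c. \<exists>x\<in>V. norm x = 1 \<and> (\<forall>z\<in>V. T x \<bullet> T z = M * (x \<bullet> z))"
proof -
  let ?U = "{x \<in> V. norm x \<le> 1}"
  obtain C where C: "C > 0" "\<And>x. x \<in> X \<Longrightarrow> norm (T x) \<le> C * norm x" using T_bounded by metis
  define M where "M = (SUP x\<in>?U. (norm (T x))\<^sup>2)"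
  have V0: "0 \<in> V" using V(1) by (rule subspace_0)
  have bdd: "bdd_above ((\<lambda>x. (norm (T x))\<^sup>2) ` ?U)"
  proof (intro bdd_aboveI2)
    fix x assume x: "x \<in> ?U"
    then have "norm (T x) \<le> C * norm x" using V(3) C(2) by auto
    also have "\<dots> \<le> C * 1" using x C(1) by (intro mult_left_mono) auto
    finally show "(norm (T x))\<^sup>2 \<le> C\<^sup>2" by (simp add: power_mono)
  qed
  have scaled: "(norm (T (inverse (norm x) *\<^sub>R x)))\<^sup>2 \<le> M" if "x \<in> V" "x \<noteq> 0" for x
    unfolding M_def using that V(1)
    by (intro cSUP_upper[OF _ bdd]) (simp add: subspace_scale)
  have M: "(norm (T x))\<^sup>2 \<le> M * (norm x)\<^sup>2" if x: "x \<in> V" for x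
  proof (cases "x = 0")
    case False
    have "x \<in> X" using x V(3) by blast
    then show ?thesis using scaled[OF x False] False
      by (simp add: T_scaleR power_mult_distrib field_simps)
  qed simp
  have "c * (norm y)\<^sup>2 < M * (norm y)\<^sup>2" using y(2) M[OF y(1)] by linarith
  then have Mc: "M > c" by (rule mult_right_less_imp_less) simp
  then have M0: "M > 0" using c by simp
  have "\<exists>x. x \<in> ?U \<and> M - inverse (real (Suc n)) < (norm (T x))\<^sup>2" for n
  proof -
    let ?I = "(\<lambda>x. (norm (T x))\<^sup>2) ` ?U"
    have "M - inverse (real (Suc n)) < M" by simp
    then have "M - inverse (real (Suc n)) < Sup ?I" unfolding M_def .
    moreover have "0 \<in> ?U" using V0 by simp
    then have "?I \<noteq> {}" by blast
    ultimately have "\<exists>q\<in>?I. M - inverse (real (Suc n)) < q" by (intro less_cSupD)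
    then show ?thesis unfolding bex_simps(7) by blast
  qed
  then have "\<exists>v. \<forall>n. v n \<in> ?U \<and> M - inverse (real (Suc n)) < (norm (T (v n)))\<^sup>2"
    by (intro choice allI)
  then obtain v where v: "\<And>n. v n \<in> ?U" "\<And>n. M - inverse (real (Suc n)) < (norm (T (v n)))\<^sup>2" by blast
  have "T (v n) \<in> closure (T ` {x \<in> X. norm x \<le> 1})" for n
  proof (rule closure_subset[THEN subsetD], rule imageI)
    show "v n \<in> {x \<in> X. norm x \<le> 1}" using v(1)[of n] V(3) by blast
  qed
  then have "\<exists>g\<in>closure (T ` {x \<in> X. norm x \<le> 1}). \<exists>r. strict_mono r \<and> ((\<lambda>n. T (v n)) \<circ> r) \<longlonglongrightarrow> g"
    using compact_ball unfolding compact_def by simp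
  then obtain g r where r: "strict_mono r" "((\<lambda>n. T (v n)) \<circ> r) \<longlonglongrightarrow> g" by blast
  define w where "w = v \<circ> r"
  have w: "w n \<in> V" "norm (w n) \<le> 1" "w n \<in> X" for n using v(1)[of "r n"] V(3) by (auto simp: w_def)
  have Tw: "(\<lambda>n. T (w n)) \<longlonglongrightarrow> g" using r(2) by (simp add: w_def o_def)
  have "M \<le> (norm g)\<^sup>2"
  proof (rule LIMSEQ_le)
    show "(\<lambda>n. (norm (T (w n)))\<^sup>2) \<longlonglongrightarrow> (norm g)\<^sup>2" by (intro tendsto_intros Tw)
    have "(\<lambda>n. M - inverse (real (Suc n))) \<longlonglongrightarrow> M - 0"
      by (intro tendsto_intros LIMSEQ_inverse_real_of_nat)
    then show "(\<lambda>n. M - inverse (real (Suc n))) \<longlonglongrightarrow> M" by simp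
    have "M - inverse (real (Suc n)) \<le> (norm (T (w n)))\<^sup>2" for n
    proof -
      have "inverse (real (Suc (r n))) \<le> inverse (real (Suc n))"
        using seq_suble[OF r(1), of n] by (intro le_imp_inverse_le) auto
      then show ?thesis using v(2)[of "r n"] unfolding w_def o_def by linarith
    qed
    then show "\<exists>N. \<forall>n\<ge>N. M - inverse (real (Suc n)) \<le> (norm (T (w n)))\<^sup>2" by blast
  qed
  have "Cauchy w"
  proof (rule metric_CauchyI)
    fix e :: real assume e: "e > 0"
    have lim: "\<forall>\<^sub>F n in sequentially. norm (T (w n) - g) < min (norm g) (M * e\<^sup>2 / (8 * norm g))"
    proof -
      have "norm g > 0" using \<open>M \<le> (norm g)\<^sup>2\<close> M0 by (cases "g = 0") auto
      then have "min (norm g) (M * e\<^sup>2 / (8 * norm g)) > 0" using M0 e by simp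
      then show ?thesis using Tw unfolding tendsto_iff dist_norm by blast
    qed
    then obtain N where N: "\<And>n. n \<ge> N \<Longrightarrow> norm (T (w n) - g) < min (norm g) (M * e\<^sup>2 / (8 * norm g))"
      unfolding eventually_sequentially by blast
    \<comment> \<open>The image of \<open>w i + w j\<close> has norm at least \<open>2 * norm g - a\<close>. The bound by \<open>norm g\<close> keeps this
      positive, so that it can be squared; the other one makes the loss \<open>4 * norm g * a\<close> less than \<open>M * e\<^sup>2\<close>.\<close>
    have "dist (w i) (w j) < e" if ij: "i \<ge> N" "j \<ge> N" for i j
    proof -
      define a where "a = norm (T (w i) - g) + norm (T (w j) - g)"
      have g: "norm g > 0" using \<open>M \<le> (norm g)\<^sup>2\<close> M0 by (cases "g = 0") auto
      have a: "a < 2 * norm g" "a < 2 * (M * e\<^sup>2 / (8 * norm g))"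
        using N[OF ij(1)] N[OF ij(2)] by (auto simp: a_def)
      have "2 *\<^sub>R g = T (w i + w j) - ((T (w i) - g) + (T (w j) - g))"
        using w by (simp add: T_add algebra_simps scaleR_2)
      then have "norm (2 *\<^sub>R g) \<le> norm (T (w i + w j)) + a"
        unfolding a_def by (smt (verit) norm_triangle_ineq norm_triangle_ineq4)
      then have "2 * norm g - a \<le> norm (T (w i + w j))" by simp
      then have "(2 * norm g - a)\<^sup>2 \<le> (norm (T (w i + w j)))\<^sup>2" using a(1) by (intro power_mono) auto
      also have "\<dots> \<le> M * (norm (w i + w j))\<^sup>2" using w V(1) by (intro M subspace_add)
      finally have 1: "(2 * norm g - a)\<^sup>2 \<le> M * (norm (w i + w j))\<^sup>2" .
      have "(2 * norm g - a)\<^sup>2 = 4 * (norm g)\<^sup>2 - 4 * norm g * a + a\<^sup>2"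
        by (simp add: power2_diff)
      moreover have "4 * norm g * a < M * e\<^sup>2" using a(2) g by (simp add: field_simps)
      ultimately have 2: "4 * M - M * e\<^sup>2 < M * (norm (w i + w j))\<^sup>2"
        using 1 \<open>M \<le> (norm g)\<^sup>2\<close> zero_le_power2[of a] by linarith
      have "4 - e\<^sup>2 < (norm (w i + w j))\<^sup>2"
      proof (rule mult_less_cancel_left_pos[OF M0, THEN iffD1])
        show "M * (4 - e\<^sup>2) < M * (norm (w i + w j))\<^sup>2"
          using 2 unfolding right_diff_distrib by (simp only: mult.commute[of M 4])
      qed
      moreover have "(norm (w i - w j))\<^sup>2 = 2 * (norm (w i))\<^sup>2 + 2 * (norm (w j))\<^sup>2 - (norm (w i + w j))\<^sup>2"
        by (simp add: power2_norm_eq_inner inner_simps inner_commute)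
      moreover have "(norm (w i))\<^sup>2 \<le> 1" "(norm (w j))\<^sup>2 \<le> 1" using w(2) by (auto simp: power_le_one)
      ultimately have "(norm (w i - w j))\<^sup>2 < e\<^sup>2" by linarith
      then show ?thesis using e by (simp add: dist_norm power_less_imp_less_base)
    qed
    then show "\<exists>N. \<forall>i\<ge>N. \<forall>j\<ge>N. dist (w i) (w j) < e" by blast
  qed
  then obtain x where x: "x \<in> V" "w \<longlonglongrightarrow> x" using V(2) w(1) unfolding complete_def by blast
  then have xX: "x \<in> X" using V(3) by blast
  have "norm x \<le> 1" using tendsto_norm[OF x(2)] by (rule LIMSEQ_le_const2) (use w(2) in auto)
  have "(\<lambda>n. T (w n)) \<longlonglongrightarrow> T x"
  proof (rule LIM_zero_cancel, rule Lim_null_comparison)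
    show "\<forall>\<^sub>F n in sequentially. norm (T (w n) - T x) \<le> C * norm (w n - x)"
      using C(2)[OF X_intros(3)[OF w(3) xX]] T_diff[OF w(3) xX] by (auto intro!: always_eventually)
    show "(\<lambda>n. C * norm (w n - x)) \<longlonglongrightarrow> 0"
      using x(2) by (intro tendsto_mult_right_zero tendsto_norm_zero) (simp add: LIM_zero_iff)
  qed
  then have "T x = g" using Tw LIMSEQ_unique by blast
  then have ge: "M \<le> (norm (T x))\<^sup>2" using \<open>M \<le> (norm g)\<^sup>2\<close> by simp
  also have "\<dots> \<le> M * (norm x)\<^sup>2" by (rule M[OF x(1)])
  finally have "1 \<le> (norm x)\<^sup>2" using M0 by simp
  then have nx: "norm x = 1" using \<open>norm x \<le> 1\<close> using power2_le_imp_le[of 1 "norm x"] by simp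
  then have eq: "(norm (T x))\<^sup>2 = M" using ge M[OF x(1)] by simp
  have "T x \<bullet> T z = M * (x \<bullet> z)" if z: "z \<in> V" for z
  proof -
    have zX: "z \<in> X" using z V(3) by blast
    have "0 \<le> (M * (norm z)\<^sup>2 - (norm (T z))\<^sup>2) * q\<^sup>2 + 2 * (M * (x \<bullet> z) - T x \<bullet> T z) * q" for q
    proof -
      have "(norm (T (x + q *\<^sub>R z)))\<^sup>2 \<le> M * (norm (x + q *\<^sub>R z))\<^sup>2"
        using x(1) z V(1) by (intro M subspace_add subspace_scale)
      moreover have "(norm (T (x + q *\<^sub>R z)))\<^sup>2 = M + 2 * (T x \<bullet> T z) * q + (norm (T z))\<^sup>2 * q\<^sup>2"
        using xX zX eq by (simp add: T_add T_scaleR X_intros power2_norm_eq_inner inner_simps inner_commute)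
          (simp add: power2_eq_square)
      moreover have "(norm (x + q *\<^sub>R z))\<^sup>2 = 1 + 2 * (x \<bullet> z) * q + (norm z)\<^sup>2 * q\<^sup>2"
        using nx unfolding norm_eq_1
        by (simp add: power2_norm_eq_inner inner_simps inner_commute) (simp add: power2_eq_square)
      ultimately show ?thesis by (simp add: algebra_simps)
    qed
    then show ?thesis using linear_term_zero_if_quadratic_nonneg by fastforce
  qed
  then show ?thesis using Mc x(1) nx by blast
qed

end


section \<open>Minimal errors are singular values\<close>

locale hilbert_compact_operator_spectrum = hilbert_compact_operator scA scB X Y T
  for scA :: "'k::{real_normed_field,banach} \<Rightarrow> 'h::real_inner \<Rightarrow> 'h"
    and scB :: "'k \<Rightarrow> 'g::real_inner \<Rightarrow> 'g"
    and X :: "'h set" and Y :: "'g set" and T :: "'h \<Rightarrow> 'g" +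
  fixes lam :: "nat \<Rightarrow> real"
  assumes ordered_eigenvalues: "ordered_eigenvalues_on scA X (adjoint_on X T \<circ> T) lam"
begin

lemma lam_antitone: "1 \<le> i \<Longrightarrow> i \<le> j \<Longrightarrow> lam j \<le> lam i"
  and lam_nonneg: "1 \<le> j \<Longrightarrow> 0 \<le> lam j"
  and finite_lam: "\<mu> > 0 \<Longrightarrow> finite {j. 1 \<le> j \<and> lam j = \<mu>}"
  and card_lam: "\<mu> > 0 \<Longrightarrow> card {j. 1 \<le> j \<and> lam j = \<mu>} = A.dim (eigenspace \<mu>)"
  using ordered_eigenvalues unfolding ordered_eigenvalues_on_def eigenspace_eq by blast+

text \<open>
  Eigenspaces of different eigenvalues are orthogonal, so bases of several eigenspaces may be
  united, and the multiplicities in the list \<open>lam\<close> count the resulting vectors.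
\<close>

lemma joint_orthonormal_eigenbasis:
  assumes M: "finite M" "\<And>\<mu>. \<mu> \<in> M \<Longrightarrow> \<mu> > 0"
  shows "\<exists>B. finite B \<and> A.orthonormal B \<and> (\<forall>b\<in>B. \<exists>\<mu>\<in>M. b \<in> eigenspace \<mu>) \<and>
    (\<forall>\<mu>\<in>M. eigenspace \<mu> \<subseteq> A.span B) \<and>
    finite {j. 1 \<le> j \<and> lam j \<in> M} \<and> card B = card {j. 1 \<le> j \<and> lam j \<in> M}"
proof -
  have "\<forall>\<mu>\<in>M. \<exists>B. finite B \<and> A.orthonormal B \<and> B \<subseteq> eigenspace \<mu> \<and> eigenspace \<mu> \<subseteq> A.span B
    \<and> card B = A.dim (eigenspace \<mu>)"
    using M(2) eigenspace_orthonormal_basis by blast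
  then obtain E where E: "\<And>\<mu>. \<mu> \<in> M \<Longrightarrow> finite (E \<mu>)" "\<And>\<mu>. \<mu> \<in> M \<Longrightarrow> A.orthonormal (E \<mu>)"
    "\<And>\<mu>. \<mu> \<in> M \<Longrightarrow> E \<mu> \<subseteq> eigenspace \<mu>" "\<And>\<mu>. \<mu> \<in> M \<Longrightarrow> eigenspace \<mu> \<subseteq> A.span (E \<mu>)"
    "\<And>\<mu>. \<mu> \<in> M \<Longrightarrow> card (E \<mu>) = A.dim (eigenspace \<mu>)"
    unfolding bchoice_iff by blast
  define B where "B = (\<Union>\<mu>\<in>M. E \<mu>)"
  define I where "I \<mu> = {j. 1 \<le> j \<and> lam j = \<mu>}" for \<mu>
  have orth: "A.orth x y" if "x \<in> E \<mu>" "y \<in> E \<nu>" "\<mu> \<in> M" "\<nu> \<in> M" "x \<noteq> y" for x y \<mu> \<nu>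
  proof (cases "\<mu> = \<nu>")
    case True
    then show ?thesis using that E(2)[of \<nu>] unfolding A.orthonormal_def pairwise_def by blast
  next
    case False
    then show ?thesis using that E(3) eigenspaces_orth by blast
  qed
  have disj: "E \<mu> \<inter> E \<nu> = {}" if "\<mu> \<in> M" "\<nu> \<in> M" "\<mu> \<noteq> \<nu>" for \<mu> \<nu>
  proof (rule ccontr)
    assume "E \<mu> \<inter> E \<nu> \<noteq> {}"
    then obtain x where x: "x \<in> E \<mu>" "x \<in> E \<nu>" by blast
    then have "A.orth x x" using that E(3) eigenspaces_orth by blast
    then have "x = 0" using A.orth_inner[of x x] by simp
    moreover have "norm x = 1" using x(1) E(2)[OF that(1)] unfolding A.orthonormal_def by blast
    ultimately show False by simp
  qed
  have I: "{j. 1 \<le> j \<and> lam j \<in> M} = (\<Union>\<mu>\<in>M. I \<mu>)" by (auto simp: I_def)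
  have finI: "finite (I \<mu>)" if "\<mu> \<in> M" for \<mu> unfolding I_def using M(2)[OF that] by (rule finite_lam)
  show ?thesis
  proof (intro exI[of _ B] conjI ballI)
    show "finite B" using M(1) E(1) by (simp add: B_def)
    show "A.orthonormal B"
      unfolding A.orthonormal_def
    proof
      show "\<forall>b\<in>B. norm b = 1" using E(2) unfolding A.orthonormal_def B_def by blast
      show "pairwise A.orth B" using orth unfolding pairwise_def B_def by blast
    qed
    show "\<exists>\<mu>\<in>M. b \<in> eigenspace \<mu>" if "b \<in> B" for b using that E(3) unfolding B_def by blast
    show "eigenspace \<mu> \<subseteq> A.span B" if "\<mu> \<in> M" for \<mu>
    proof -
      have "E \<mu> \<subseteq> B" using that unfolding B_def by blast
      then show ?thesis using E(4)[OF that] A.span_mono by blast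
    qed
    show "finite {j. 1 \<le> j \<and> lam j \<in> M}" unfolding I using M(1) finI by blast
    have "card B = (\<Sum>\<mu>\<in>M. card (E \<mu>))"
      unfolding B_def using M(1) E(1) disj by (intro card_UN_disjoint) blast+
    also have "\<dots> = (\<Sum>\<mu>\<in>M. card (I \<mu>))"
      using E(5) M(2) card_lam by (intro sum.cong) (simp_all add: I_def)
    also have "\<dots> = card (\<Union>\<mu>\<in>M. I \<mu>)"
      using M(1) finI by (intro card_UN_disjoint[symmetric]) (auto simp: I_def)
    finally show "card B = card {j. 1 \<le> j \<and> lam j \<in> M}" unfolding I .
  qed
qed

lemma lam_null: "lam \<longlonglongrightarrow> 0"
  unfolding tendsto_iff dist_real_def
proof safe
  fix c :: real assume c: "c > 0"
  obtain N where N: "\<And>B. finite B \<and> A.orthonormal B \<and> (\<forall>b\<in>B. \<exists>\<mu>\<ge>c. b \<in> eigenspace \<mu>) \<Longrightarrow> card B \<le> N"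
    using card_large_eigensystem_bounded[OF c] by blast
  have small: "lam (Suc N) < c"
  proof (rule ccontr)
    assume "\<not> lam (Suc N) < c"
    then have ge: "lam j \<ge> c" if "j \<in> {1..Suc N}" for j
      using lam_antitone[of j "Suc N"] that by simp
    define M where "M = lam ` {1..Suc N}"
    have M: "finite M" "\<And>\<mu>. \<mu> \<in> M \<Longrightarrow> \<mu> \<ge> c" using ge by (auto simp: M_def)
    have M0: "\<And>\<mu>. \<mu> \<in> M \<Longrightarrow> \<mu> > 0" using M(2) c by fastforce
    obtain B where B: "finite B" "A.orthonormal B" "\<And>b. b \<in> B \<Longrightarrow> \<exists>\<mu>\<in>M. b \<in> eigenspace \<mu>"
      "finite {j. 1 \<le> j \<and> lam j \<in> M}" "card B = card {j. 1 \<le> j \<and> lam j \<in> M}"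
      using joint_orthonormal_eigenbasis[OF M(1) M0] by blast
    have "card B \<le> N" using B(1-3) M(2) by (intro N) blast
    moreover have "card {1..Suc N} \<le> card B" unfolding B(5) by (intro card_mono B) (auto simp: M_def)
    ultimately show False by simp
  qed
  show "\<forall>\<^sub>F j in sequentially. \<bar>lam j - 0\<bar> < c"
    using eventually_ge_at_top[of "Suc N"]
  proof eventually_elim
    case (elim j)
    then show ?case using small lam_antitone[of "Suc N" j] lam_nonneg[of j] by simp
  qed
qed

lemma functional_sum:
  assumes L: "linear_map_on scA (*) X L" and B: "finite B" "B \<subseteq> X"
  shows "L (\<Sum>b\<in>B. scA (c b) b) = (\<Sum>b\<in>B. c b * L b)"
  using B
proof (induction B rule: finite_induct)
  case empty
  have "L (scA 0 0) = 0 * L 0" using L X_intros(1) unfolding linear_map_on_def by blast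
  then show ?case by simp
next
  case (insert b B)
  then have "b \<in> X" "B \<subseteq> X" by auto
  moreover have "(\<Sum>b\<in>B. scA (c b) b) \<in> X" using \<open>B \<subseteq> X\<close> by (rule sum_sc_in_X)
  ultimately show ?case
    using insert L X_intros(4) by (simp add: linear_map_on_def)
qed

lemma bounded_functional:
  assumes L: "linear_map_on scA (*) X L" "continuous_on X L"
  shows "\<exists>C. \<forall>f\<in>X. norm f \<le> 1 \<longrightarrow> norm (L f) \<le> C"
proof -
  have L0: "L 0 = 0" using functional_sum[OF L(1), of "{}"] by simp
  obtain e where e: "e > 0" "\<And>f. f \<in> X \<Longrightarrow> dist f 0 < e \<Longrightarrow> dist (L f) (L 0) < 1"
    using L(2)[unfolded continuous_on_iff, rule_format, OF X_intros(1) zero_less_one] by blast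
  have "norm (L f) \<le> 2 / e" if f: "f \<in> X" "norm f \<le> 1" for f
  proof -
    have "norm ((e / 2) *\<^sub>R f) < e" using e(1) f(2) mult_left_mono[of "norm f" 1 "e / 2"] by simp
    then have "dist (L ((e / 2) *\<^sub>R f)) (L 0) < 1" using f(1) by (intro e(2) X_intros) (simp_all add: dist_norm)
    moreover have "L ((e / 2) *\<^sub>R f) = of_real (e / 2) * L f"
      using L(1) f(1) unfolding A.sc_of_real[symmetric] linear_map_on_def by blast
    ultimately have "e / 2 * norm (L f) < 1" using e(1) by (simp add: L0 norm_mult)
    then show ?thesis using e(1) by (simp add: field_simps)
  qed
  then show ?thesis by (intro exI[of _ "2 / e"]) simp
qed

text \<open>
  A supremum of reals bounds its members only when the set is bounded above, so every lower
  bound for a worst case error depends on this.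
\<close>

lemma bdd_above_algorithm_error:
  assumes "P \<in> algorithms scA scB X Y n"
  shows "bdd_above ((\<lambda>f. norm (T f - P f)) ` {f \<in> X. norm f \<le> 1})"
proof -
  from assms obtain m L g
    where "m \<le> n" and "\<forall>i<m. linear_map_on scA (*) X (L i) \<and> continuous_on X (L i) \<and> g i \<in> Y"
      and P: "P = (\<lambda>f. \<Sum>i<m. scB (L i f) (g i))"
    unfolding algorithms_def mem_Collect_eq by (elim exE conjE) (rule that)
  then have L: "\<And>i. i < m \<Longrightarrow> linear_map_on scA (*) X (L i)" "\<And>i. i < m \<Longrightarrow> continuous_on X (L i)"
    by simp_all
  have "\<exists>C. i < m \<longrightarrow> (\<forall>f\<in>X. norm f \<le> 1 \<longrightarrow> norm (L i f) \<le> C)" for i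
    using bounded_functional[OF L, of i] by blast
  then have "\<exists>K. \<forall>i. i < m \<longrightarrow> (\<forall>f\<in>X. norm f \<le> 1 \<longrightarrow> norm (L i f) \<le> K i)"
    by (intro choice allI)
  then obtain K where K: "\<And>i f. i < m \<Longrightarrow> f \<in> X \<Longrightarrow> norm f \<le> 1 \<Longrightarrow> norm (L i f) \<le> K i"
    by blast
  obtain C where C: "C > 0" "\<And>x. x \<in> X \<Longrightarrow> norm (T x) \<le> C * norm x" using T_bounded by metis
  show ?thesis
  proof (intro bdd_aboveI2)
    fix f assume "f \<in> {f \<in> X. norm f \<le> 1}"
    then have f: "f \<in> X" "norm f \<le> 1" by auto
    have "C * norm f \<le> C * 1" using f(2) C(1) by (intro mult_left_mono) auto
    then have "norm (T f) \<le> C" using C(2)[OF f(1)] by linarith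
    moreover have "norm (P f) \<le> (\<Sum>i<m. K i * norm (g i))"
      unfolding P using f by (intro sum_norm_le) (auto simp: B.norm_sc intro!: mult_right_mono K)
    ultimately show "norm (T f - P f) \<le> C + (\<Sum>i<m. K i * norm (g i))"
      using norm_triangle_ineq4[of "T f" "P f"] by linarith
  qed
qed

text \<open>
  Let \<open>lam (Suc n) > 0\<close>. There are more leading eigenvectors than functionals, so all functionals vanish at some unit
  vector \<open>u\<close> in their span. The algorithm returns \<open>0\<close> for \<open>u\<close>, while by Pythagoras
  \<open>T u\<close> has norm at least \<open>sqrt (lam (Suc n))\<close>.
\<close>

lemma worst_case_error_ge:
  assumes P: "P \<in> algorithms scA scB X Y n"
  shows "sqrt (lam (Suc n)) \<le> worst_case_error X T P"
proof (cases "lam (Suc n) = 0")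
  case True
  have "norm (T 0 - P 0) \<le> worst_case_error X T P"
    unfolding worst_case_error_def
    by (intro cSUP_upper bdd_above_algorithm_error[OF P]) (simp add: X_intros(1))
  then show ?thesis using True norm_ge_zero[of "T 0 - P 0"] by (simp only: real_sqrt_zero)
next
  case False
  then have pos: "lam (Suc n) > 0" using lam_nonneg[of "Suc n"] by simp
  from P obtain m L g where m: "m \<le> n"
    and "\<forall>i<m. linear_map_on scA (*) X (L i) \<and> continuous_on X (L i) \<and> g i \<in> Y"
    and P_def: "P = (\<lambda>f. \<Sum>i<m. scB (L i f) (g i))"
    unfolding algorithms_def mem_Collect_eq by (elim exE conjE) (rule that)
  then have L: "\<And>i. i < m \<Longrightarrow> linear_map_on scA (*) X (L i)" by simp
  define M where "M = lam ` {1..Suc n}"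
  have M: "finite M" "\<And>\<mu>. \<mu> \<in> M \<Longrightarrow> \<mu> \<ge> lam (Suc n)"
    using lam_antitone by (auto simp: M_def)
  have M0: "\<And>\<mu>. \<mu> \<in> M \<Longrightarrow> \<mu> > 0" using M(2) pos by fastforce
  obtain B where B: "finite B" "A.orthonormal B" "\<And>b. b \<in> B \<Longrightarrow> \<exists>\<mu>\<in>M. b \<in> eigenspace \<mu>"
    "finite {j. 1 \<le> j \<and> lam j \<in> M}" "card B = card {j. 1 \<le> j \<and> lam j \<in> M}"
    using joint_orthonormal_eigenbasis[OF M(1) M0] by blast
  have BX: "B \<subseteq> X" using B(3) eigenspace_X by blast
  have b1: "norm b = 1" if "b \<in> B" for b using B(2) that by (simp add: A.orthonormal_def)
  have bo: "A.orth b b'" if "b \<in> B" "b' \<in> B" "b \<noteq> b'" for b b'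
    using B(2) that by (simp add: A.orthonormal_def pairwise_def)
  have "card {1..Suc n} \<le> card B" unfolding B(5) by (intro card_mono B) (auto simp: M_def)
  then have "m < card B" using m by simp
  then obtain c where c: "\<exists>b\<in>B. c b \<noteq> 0" "\<And>i. i < m \<Longrightarrow> (\<Sum>b\<in>B. L i b * c b) = 0"
    using underdetermined_system_solution[OF B(1) \<open>m < card B\<close>, of L] by (elim exE conjE) simp
  define x where "x = (\<Sum>b\<in>B. scA (c b) b)"
  have xX: "x \<in> X" unfolding x_def using BX by (rule sum_sc_in_X)
  have nx: "(norm x)\<^sup>2 = (\<Sum>b\<in>B. (norm (c b))\<^sup>2)"
    unfolding x_def using A.norm_sum_orth[OF B(1), of "\<lambda>b. b" c] bo b1 by (simp add: pairwise_def)
  obtain b0 where b0: "b0 \<in> B" "c b0 \<noteq> 0" using c(1) by blast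
  have "0 < (\<Sum>b\<in>B. (norm (c b))\<^sup>2)"
    by (rule sum_pos2[OF B(1) b0(1)]) (simp_all add: b0(2))
  then have x0: "norm x > 0" unfolding nx[symmetric] by (simp add: zero_less_power2)
  have "lam (Suc n) * (norm x)\<^sup>2 = (\<Sum>b\<in>B. (norm (c b))\<^sup>2 * lam (Suc n))"
    unfolding nx by (simp add: sum_distrib_left mult.commute)
  also have "\<dots> \<le> (\<Sum>b\<in>B. (norm (c b))\<^sup>2 * (norm (T b))\<^sup>2)"
  proof (intro sum_mono mult_left_mono)
    fix b assume b: "b \<in> B"
    then obtain \<mu> where "\<mu> \<in> M" "b \<in> eigenspace \<mu>" using B(3) by blast
    then show "lam (Suc n) \<le> (norm (T b))\<^sup>2" using M(2) b1[OF b] by (simp add: norm_image_eigenvector)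
  qed simp
  also have "\<dots> = (norm (T x))\<^sup>2"
  proof -
    have "pairwise (\<lambda>b b'. B.orth (T b) (T b')) B"
      unfolding pairwise_def
    proof (intro ballI impI)
      fix b b' assume b: "b \<in> B" "b' \<in> B" "b \<noteq> b'"
      then obtain \<mu> where "b' \<in> eigenspace \<mu>" using B(3) by blast
      then show "B.orth (T b) (T b')"
        using b BX bo by (intro orth_image_of_eigenvector[of b' \<mu> b]) auto
    qed
    then show ?thesis
      unfolding x_def T_sum_sc[OF BX] by (intro B.norm_sum_orth[OF B(1), symmetric])
  qed
  finally have "lam (Suc n) * (norm x)\<^sup>2 \<le> (norm (T x))\<^sup>2" .
  then have Tx: "sqrt (lam (Suc n)) * norm x \<le> norm (T x)"
    using real_sqrt_le_mono by (fastforce simp: real_sqrt_mult)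
  define u where "u = scA (of_real (inverse (norm x))) x"
  have uX: "u \<in> X" unfolding u_def using xX by (rule X_intros)
  have "norm u = 1" using x0 by (simp add: u_def A.norm_sc norm_inverse)
  have "P u = 0"
    unfolding P_def
  proof (intro sum.neutral ballI)
    fix i assume "i \<in> {..<m}"
    then have i: "i < m" by simp
    have "L i x = 0" unfolding x_def functional_sum[OF L[OF i] B(1) BX] using c(2)[OF i] by (simp add: mult.commute)
    moreover have "L i u = of_real (inverse (norm x)) * L i x"
      using L[OF i] xX unfolding u_def linear_map_on_def by blast
    ultimately show "scB (L i u) (g i) = 0" by simp
  qed
  have "sqrt (lam (Suc n)) \<le> norm (T x) / norm x" using Tx x0 by (simp add: pos_le_divide_eq)
  also have "\<dots> = norm (T u)"
    unfolding u_def using xX x0 by (simp add: norm_inverse T_sc B.norm_sc divide_inverse mult.commute)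
  also have "\<dots> = norm (T u - P u)" by (simp add: \<open>P u = 0\<close>)
  also have "\<dots> \<le> worst_case_error X T P"
    unfolding worst_case_error_def
    by (intro cSUP_upper bdd_above_algorithm_error[OF P]) (simp add: uX \<open>norm u = 1\<close>)
  finally show ?thesis .
qed

text \<open>
  Otherwise the maximizer of \<open>norm (T x)\<close> on the orthogonal complement \<open>V\<close> of \<open>B\<close> would satisfy the
  eigenvector equation with a value \<open>M > c\<close>. Since \<open>T\<close> maps \<open>B\<close> and \<open>V\<close> to orthogonal sets, that
  equation extends from \<open>V\<close> to the whole space, and the maximizer would lie in the span of \<open>B\<close> and
  be orthogonal to \<open>B\<close> at once.
\<close>

lemma norm_image_le_off_leading_eigenspaces:
  assumes B: "finite B" "A.orthonormal B" "\<And>b. b \<in> B \<Longrightarrow> \<exists>\<mu>. b \<in> eigenspace \<mu>"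
    and leading: "\<And>\<mu>. \<mu> > c \<Longrightarrow> eigenspace \<mu> \<subseteq> A.span B" and c: "c \<ge> 0"
    and y: "y \<in> X" "\<And>b. b \<in> B \<Longrightarrow> A.orth b y"
  shows "(norm (T y))\<^sup>2 \<le> c * (norm y)\<^sup>2"
proof (rule ccontr)
  assume greater: "\<not> (norm (T y))\<^sup>2 \<le> c * (norm y)\<^sup>2"
  define V where "V = {x \<in> X. \<forall>b\<in>B. A.orth b x}"
  have VX: "V \<subseteq> X" by (auto simp: V_def)
  have "A.subspace V"
    unfolding A.subspace_def V_def using X_intros by (auto simp: A.orth_add_right A.orth_sc_right) (simp add: A.orth_def)
  then have subV: "real_vector.subspace V" by (rule A.subspace_imp_real_subspace)
  have comV: "complete V"
    unfolding complete_def
  proof safe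
    fix f assume f: "\<forall>n. f n \<in> V" "Cauchy f"
    then have "\<forall>n. f n \<in> X" using VX by blast
    then obtain z where z: "z \<in> X" "f \<longlonglongrightarrow> z" using com_X f(2) unfolding complete_def by blast
    have "A.orth b z" if b: "b \<in> B" for b
      unfolding A.orth_def
    proof
      fix a
      have "(\<lambda>n. scA a b \<bullet> f n) \<longlonglongrightarrow> scA a b \<bullet> z" by (intro tendsto_intros z)
      moreover have "scA a b \<bullet> f n = 0" for n using f(1) b unfolding V_def A.orth_def by blast
      ultimately show "scA a b \<bullet> z = 0" by (simp add: LIMSEQ_const_iff)
    qed
    then show "\<exists>z\<in>V. f \<longlonglongrightarrow> z" using z unfolding V_def by blast
  qed
  have "y \<in> V" using y unfolding V_def by blast
  then obtain M x where x: "M > c" "x \<in> V" "norm x = 1" "\<And>z. z \<in> V \<Longrightarrow> T x \<bullet> T z = M * (x \<bullet> z)"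
    using maximizer_is_eigenvector[OF subV comV VX] greater c by (metis not_le)
  have xX: "x \<in> X" using x(2) VX by blast
  have xb: "A.orth x b" if "b \<in> B" for b using x(2) that A.orth_sym unfolding V_def by blast
  have "T x \<bullet> T z = M * (x \<bullet> z)" if z: "z \<in> X" for z
  proof -
    have BX: "B \<subseteq> X" using B(3) eigenspace_X by blast
    have pX: "A.proj B z \<in> X" unfolding A.proj_def by (rule sum_sc_in_X[OF BX])
    have rV: "z - A.proj B z \<in> V" unfolding V_def using z pX A.orth_residual[OF B(1,2)] X_intros(3) by blast
    have "A.orth x (A.proj B z)"
      unfolding A.proj_def by (intro A.orth_sum_right A.orth_sc_right xb)
    then have 1: "x \<bullet> A.proj B z = 0" by (rule A.orth_inner)
    have "B.orth (T x) (T b)" if "b \<in> B" for b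
      using B(3)[OF that] orth_image_of_eigenvector[OF _ xX xb[OF that]] by blast
    then have "B.orth (T x) (T (A.proj B z))"
      unfolding A.proj_def T_sum_sc[OF BX] by (intro B.orth_sum_right B.orth_sc_right)
    then have 2: "T x \<bullet> T (A.proj B z) = 0" by (rule B.orth_inner)
    show ?thesis
      using x(4)[OF rV] 1 2 by (simp add: T_diff[OF z pX] inner_diff_right)
  qed
  then have "x \<in> eigenspace M" using xX unfolding eigenspace_def by blast
  then have "x \<in> A.span B" using leading[OF x(1)] by blast
  moreover have "A.subspace {y. A.orth x y}"
    unfolding A.subspace_def by (auto simp: A.orth_add_right A.orth_sc_right) (simp add: A.orth_def)
  ultimately have "A.orth x x" using A.span_minimal[of B "{y. A.orth x y}"] xb by blast
  then have "x \<bullet> x = 0" by (rule A.orth_inner)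
  then show False using x(3) by simp
qed

text \<open>
  Only eigenvalues strictly above \<open>lam (Suc n)\<close> are used: their number with multiplicity is at most
  \<open>n\<close> even when \<open>lam n = lam (Suc n)\<close>, and their eigenspaces are taken whole.
\<close>

lemma optimal_algorithm:
  "\<exists>P\<in>algorithms scA scB X Y n. worst_case_error X T P \<le> sqrt (lam (Suc n))"
proof -
  define M where "M = lam ` {j \<in> {1..n}. lam j > lam (Suc n)}"
  have M: "finite M" "\<And>\<mu>. \<mu> \<in> M \<Longrightarrow> \<mu> > lam (Suc n)" by (auto simp: M_def)
  have M0: "\<And>\<mu>. \<mu> \<in> M \<Longrightarrow> \<mu> > 0" using M(2) lam_nonneg[of "Suc n"] by fastforce
  obtain B where B: "finite B" "A.orthonormal B" "\<And>b. b \<in> B \<Longrightarrow> \<exists>\<mu>\<in>M. b \<in> eigenspace \<mu>"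
    "\<And>\<mu>. \<mu> \<in> M \<Longrightarrow> eigenspace \<mu> \<subseteq> A.span B"
    "card B = card {j. 1 \<le> j \<and> lam j \<in> M}"
    using joint_orthonormal_eigenbasis[OF M(1) M0] by blast
  have early: "j \<le> n" if "1 \<le> j" "lam j > lam (Suc n)" for j
    using lam_antitone[of "Suc n" j] that by (cases "j \<le> n") auto
  have "{j. 1 \<le> j \<and> lam j \<in> M} \<subseteq> {1..n}" using M(2) early by auto
  then have cB: "card B \<le> n" unfolding B(5) using card_mono[of "{1..n}"] by fastforce
  have BX: "B \<subseteq> X" using B(3) eigenspace_X by blast
  have b1: "norm b = 1" if "b \<in> B" for b using B(2) that by (simp add: A.orthonormal_def)
  \<comment> \<open>Eigenvalues above \<open>lam (Suc n)\<close> that do not occur in the list have multiplicity zero.\<close>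
  have leading: "eigenspace \<mu> \<subseteq> A.span B" if "\<mu> > lam (Suc n)" for \<mu>
  proof (cases "\<mu> \<in> M")
    case False
    have pos: "\<mu> > 0" using that lam_nonneg[of "Suc n"] by simp
    have "{j. 1 \<le> j \<and> lam j = \<mu>} = {}" using False that early unfolding M_def by auto
    then have "A.dim (eigenspace \<mu>) = 0" using card_lam[OF pos] by (simp only: card.empty)
    then obtain E where "finite E" "eigenspace \<mu> \<subseteq> A.span E" "card E = 0"
      using eigenspace_orthonormal_basis[OF pos] by metis
    then have "eigenspace \<mu> \<subseteq> A.span {}" by simp
    then show ?thesis using A.span_mono[of "{}" B] by blast
  qed (rule B(4))
  obtain h where h: "bij_betw h {..<card B} B"
    using ex_bij_betw_nat_finite[OF B(1)] by (auto simp: lessThan_atLeast0)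
  have hB: "h i \<in> B" if "i < card B" for i using h that by (auto simp: bij_betw_def)
  define P where "P = (\<lambda>f. \<Sum>i<card B. scB (A.coef (h i) f) (T (h i)))"
  have P_eq: "P f = T (A.proj B f)" for f
    unfolding P_def A.proj_def T_sum_sc[OF BX] by (rule sum.reindex_bij_betw[OF h])
  have "P \<in> algorithms scA scB X Y n"
    unfolding algorithms_def
  proof (intro CollectI exI conjI)
    show "card B \<le> n" by (rule cB)
    show "P = (\<lambda>f. \<Sum>i<card B. scB (A.coef (h i) f) (T (h i)))" by (rule P_def)
    show "\<forall>i<card B. linear_map_on scA (*) X (A.coef (h i)) \<and> continuous_on X (A.coef (h i)) \<and> T (h i) \<in> Y"
      using hB b1 BX T_Y unfolding linear_map_on_def
      by (auto simp: A.coef_add A.coef_sc intro!: A.continuous_on_coef)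
  qed
  moreover have "worst_case_error X T P \<le> sqrt (lam (Suc n))"
    unfolding worst_case_error_def
  proof (rule cSUP_least)
    show "{f \<in> X. norm f \<le> 1} \<noteq> {}" using X_intros(1) by (auto intro!: exI[of _ 0])
    fix f assume "f \<in> {f \<in> X. norm f \<le> 1}"
    then have f: "f \<in> X" "norm f \<le> 1" by auto
    have pX: "A.proj B f \<in> X" unfolding A.proj_def by (rule sum_sc_in_X[OF BX])
    define r where "r = f - A.proj B f"
    have "(norm (T r))\<^sup>2 \<le> lam (Suc n) * (norm r)\<^sup>2"
    proof (rule norm_image_le_off_leading_eigenspaces[OF B(1,2) _ leading])
      show "\<exists>\<mu>. b \<in> eigenspace \<mu>" if "b \<in> B" for b using B(3)[OF that] by blast
      show "0 \<le> lam (Suc n)" by (rule lam_nonneg) simp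
      show "r \<in> X" unfolding r_def using f(1) pX by (rule X_intros)
      show "A.orth b r" if "b \<in> B" for b unfolding r_def by (rule A.orth_residual[OF B(1,2) that])
    qed
    also have "norm r \<le> 1" unfolding r_def using A.norm_residual_le[OF B(1,2), of f] f(2) by linarith
    then have "lam (Suc n) * (norm r)\<^sup>2 \<le> lam (Suc n) * 1"
      using lam_nonneg[of "Suc n"] by (intro mult_left_mono power_le_one) auto
    finally have "norm (T r) \<le> sqrt (lam (Suc n))" by (intro real_le_rsqrt) simp
    then show "norm (T f - P f) \<le> sqrt (lam (Suc n))"
      unfolding P_eq r_def T_diff[OF f(1) pX] .
  qed
  ultimately show ?thesis by blast
qed

theorem minimal_error_eq: "minimal_error scA scB X Y T n = sqrt (lam (Suc n))"
proof (rule antisym)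
  obtain P where P: "P \<in> algorithms scA scB X Y n" "worst_case_error X T P \<le> sqrt (lam (Suc n))"
    using optimal_algorithm by blast
  have "bdd_below (worst_case_error X T ` algorithms scA scB X Y n)"
    by (intro bdd_belowI2[of _ "sqrt (lam (Suc n))"] worst_case_error_ge)
  then have "minimal_error scA scB X Y T n \<le> worst_case_error X T P"
    unfolding minimal_error_def using P(1) by (rule cINF_lower)
  then show "minimal_error scA scB X Y T n \<le> sqrt (lam (Suc n))" using P(2) by (rule order_trans)
  show "sqrt (lam (Suc n)) \<le> minimal_error scA scB X Y T n"
    unfolding minimal_error_def using P(1) by (intro cINF_greatest worst_case_error_ge) auto
qed

end


section \<open>Tractability in terms of the spectrum\<close>

text \<open>
  The exchange between a logarithmic bound on the complexity (left) and a decay bound on the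
  spectrum (right), where \<open>\<epsilon>\<^sup>2\<close> stands for an eigenvalue.
\<close>

lemma le_mult_powr_iff:
  fixes l a \<epsilon> s :: real
  assumes "0 \<le> l" "0 < a" "0 < \<epsilon>" "0 < s"
  shows "l \<le> a * \<epsilon> powr (- s) \<longleftrightarrow> \<epsilon>\<^sup>2 * l powr (2 / s) \<le> a powr (2 / s)"
proof -
  let ?p = "2 / s"
  have "(a * \<epsilon> powr (- s)) powr ?p = a powr ?p * \<epsilon> powr (- s * ?p)"
    using assms by (simp add: powr_mult powr_powr)
  also have "- s * ?p = - 2" using assms by simp
  also have "\<epsilon> powr (- 2) = inverse (\<epsilon>\<^sup>2)" using assms by (simp add: powr_minus powr_numeral)
  finally have "(a * \<epsilon> powr (- s)) powr ?p = a powr ?p / \<epsilon>\<^sup>2" by (simp add: divide_inverse)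
  moreover have "l \<le> y \<longleftrightarrow> l powr ?p \<le> y powr ?p" if "0 \<le> y" for y
    using that assms powr_mono2[of ?p l y] powr_less_mono2[of ?p y l] by (auto simp: not_less[symmetric])
  ultimately show ?thesis using assms by (simp add: pos_le_divide_eq mult.commute)
qed

text \<open>
  If the uniform statement fails for some \<open>\<delta>\<close>, violating pairs for the thresholds \<open>K = 0, 1, 2, \<dots>\<close>
  form a sequence along which \<open>F\<close> does not tend to zero.
\<close>

lemma sequential_null_limit_iff:
  fixes P :: "real \<Rightarrow> nat \<Rightarrow> bool" and sz F :: "real \<Rightarrow> nat \<Rightarrow> real"
  shows "(\<forall>\<epsilon> d. (\<forall>k. P (\<epsilon> k) (d k)) \<and> filterlim (\<lambda>k. sz (\<epsilon> k) (d k)) at_top sequentially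
            \<longrightarrow> (\<lambda>k. F (\<epsilon> k) (d k)) \<longlonglongrightarrow> 0) \<longleftrightarrow>
         (\<forall>\<delta>>0. \<exists>K. \<forall>\<epsilon> d. P \<epsilon> d \<and> K \<le> sz \<epsilon> d \<longrightarrow> \<bar>F \<epsilon> d\<bar> < \<delta>)" (is "?seq \<longleftrightarrow> ?unif")
proof
  assume seq: ?seq
  show ?unif
  proof (rule ccontr)
    assume "\<not> ?unif"
    then obtain \<delta> where \<delta>: "\<delta> > 0" "\<forall>K. \<exists>\<epsilon> d. P \<epsilon> d \<and> K \<le> sz \<epsilon> d \<and> \<not> \<bar>F \<epsilon> d\<bar> < \<delta>" by blast
    then have "\<forall>k. \<exists>\<epsilon> d. P \<epsilon> d \<and> real k \<le> sz \<epsilon> d \<and> \<not> \<bar>F \<epsilon> d\<bar> < \<delta>" by blast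
    then obtain \<epsilon> d where ed: "\<And>k::nat. P (\<epsilon> k) (d k)" "\<And>k. real k \<le> sz (\<epsilon> k) (d k)"
      "\<And>k. \<not> \<bar>F (\<epsilon> k) (d k)\<bar> < \<delta>" by metis
    have "filterlim (\<lambda>k. sz (\<epsilon> k) (d k)) at_top sequentially"
      by (rule filterlim_at_top_mono[OF filterlim_real_sequentially]) (use ed(2) in auto)
    then have "(\<lambda>k. F (\<epsilon> k) (d k)) \<longlonglongrightarrow> 0" using seq ed(1) by blast
    then have "\<forall>\<^sub>F k in sequentially. \<bar>F (\<epsilon> k) (d k)\<bar> < \<delta>"
      using \<delta>(1) by (auto simp: tendsto_iff dist_real_def)
    then show False using ed(3) by simp
  qed
next
  assume unif: ?unif
  show ?seq
  proof safe
    fix \<epsilon> :: "nat \<Rightarrow> real" and d :: "nat \<Rightarrow> nat"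
    assume P: "\<forall>k. P (\<epsilon> k) (d k)" and lim: "filterlim (\<lambda>k. sz (\<epsilon> k) (d k)) at_top sequentially"
    show "(\<lambda>k. F (\<epsilon> k) (d k)) \<longlonglongrightarrow> 0"
      unfolding tendsto_iff dist_real_def
    proof safe
      fix \<delta> :: real assume "\<delta> > 0"
      then obtain K where K: "\<And>\<epsilon> d. P \<epsilon> d \<Longrightarrow> K \<le> sz \<epsilon> d \<Longrightarrow> \<bar>F \<epsilon> d\<bar> < \<delta>" using unif by blast
      from lim have "\<forall>\<^sub>F k in sequentially. K \<le> sz (\<epsilon> k) (d k)" by (simp add: filterlim_at_top)
      then show "\<forall>\<^sub>F k in sequentially. \<bar>F (\<epsilon> k) (d k) - 0\<bar> < \<delta>"
        by eventually_elim (use K P in auto)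
    qed
  qed
qed

lemma powr_sum_large:
  fixes s t C :: real
  assumes "s > 0" "t > 0"
  shows "\<exists>K. \<forall>\<epsilon> d::nat. 0 < \<epsilon> \<and> K \<le> inverse \<epsilon> + real d \<longrightarrow> C \<le> \<epsilon> powr (- s) + real d powr t"
proof -
  define C' where "C' = max 1 C"
  have "C \<le> \<epsilon> powr (- s) + real d powr t"
    if e: "0 < \<epsilon>" and K: "C' powr (1 / s) + C' powr (1 / t) \<le> inverse \<epsilon> + real d" for \<epsilon> and d :: nat
  proof -
    have C': "C' > 0" "C \<le> C'" by (auto simp: C'_def)
    consider "C' powr (1 / s) \<le> inverse \<epsilon>" | "C' powr (1 / t) \<le> real d" using K by linarith
    then have "C' \<le> \<epsilon> powr (- s) \<or> C' \<le> real d powr t"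
    proof cases
      case 1
      then have "(C' powr (1 / s)) powr s \<le> inverse \<epsilon> powr s" using assms by (intro powr_mono2) auto
      then show ?thesis using C' assms e by (simp add: powr_powr powr_minus inverse_powr powr_one)
    next
      case 2
      then have "(C' powr (1 / t)) powr t \<le> real d powr t" using assms by (intro powr_mono2) auto
      then show ?thesis using C' assms by (simp add: powr_powr powr_one)
    qed
    then show ?thesis using C'(2) powr_ge_zero[of \<epsilon> "- s"] powr_ge_zero[of "real d" t] by linarith
  qed
  then show ?thesis by blast
qed

text \<open>
  \<open>\<mu> d\<close> plays the role of the eigenvalues of the \<open>d\<close>-th problem, divided by its normalizing
  constant.
\<close>

locale spectrum_family =
  fixes \<mu> :: "nat \<Rightarrow> nat \<Rightarrow> real" and s t :: real
  assumes antitone: "\<And>d i j. 1 \<le> d \<Longrightarrow> 1 \<le> i \<Longrightarrow> i \<le> j \<Longrightarrow> \<mu> d j \<le> \<mu> d i"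
    and nonneg: "\<And>d j. 1 \<le> d \<Longrightarrow> 1 \<le> j \<Longrightarrow> 0 \<le> \<mu> d j"
    and null: "\<And>d. 1 \<le> d \<Longrightarrow> \<mu> d \<longlonglongrightarrow> 0"
    and s_pos: "s > 0" and t_pos: "t > 0"
begin

definition complexity :: "real \<Rightarrow> nat \<Rightarrow> nat" where
  "complexity \<epsilon> d = (LEAST n. \<mu> d (Suc n) \<le> \<epsilon>\<^sup>2)"

text \<open>
  The limit relation of weak tractability, stated with a threshold instead of sequences.
\<close>

definition tractable :: bool where
  "tractable \<longleftrightarrow> (\<forall>\<delta>>0. \<exists>K. \<forall>\<epsilon> d. (0 < \<epsilon> \<and> \<epsilon> \<le> 1 \<and> 1 \<le> d \<and> \<epsilon>\<^sup>2 < \<mu> d 1) \<and> K \<le> inverse \<epsilon> + real d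
     \<longrightarrow> \<bar>ln (real (complexity \<epsilon> d)) / (\<epsilon> powr (- s) + real d powr t)\<bar> < \<delta>)"

lemma index_le_complexity:
  assumes "1 \<le> d" "0 < \<epsilon>" "1 \<le> j" "\<epsilon>\<^sup>2 < \<mu> d j"
  shows "j \<le> complexity \<epsilon> d"
proof (rule ccontr)
  assume less: "\<not> j \<le> complexity \<epsilon> d"
  have "\<forall>\<^sub>F j in sequentially. \<mu> d j < \<epsilon>\<^sup>2"
    using null[OF assms(1)] assms(2) by (intro order_tendstoD) auto
  then obtain n where "\<mu> d (Suc n) < \<epsilon>\<^sup>2" unfolding eventually_sequentially by (meson le_Suc_eq le_refl)
  then have "\<mu> d (Suc n) \<le> \<epsilon>\<^sup>2" by simp
  then have "\<mu> d (Suc (complexity \<epsilon> d)) \<le> \<epsilon>\<^sup>2" unfolding complexity_def by (rule LeastI)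
  moreover have "\<mu> d j \<le> \<mu> d (Suc (complexity \<epsilon> d))" using less assms by (intro antitone) auto
  ultimately show False using assms(4) by simp
qed

lemma less_spectrum_at_complexity:
  assumes "1 \<le> complexity \<epsilon> d"
  shows "\<epsilon>\<^sup>2 < \<mu> d (complexity \<epsilon> d)"
  using not_less_Least[of "complexity \<epsilon> d - 1" "\<lambda>n. \<mu> d (Suc n) \<le> \<epsilon>\<^sup>2"] assms by (simp add: complexity_def not_le)

lemma tractableD:
  assumes tractable "\<delta> > 0"
  obtains K where "\<And>\<epsilon> d j. 0 < \<epsilon> \<Longrightarrow> \<epsilon> \<le> 1 \<Longrightarrow> 1 \<le> d \<Longrightarrow> 1 \<le> j \<Longrightarrow> \<epsilon>\<^sup>2 < \<mu> d j
    \<Longrightarrow> K \<le> inverse \<epsilon> + real d \<Longrightarrow> ln (real j) \<le> \<delta> * (\<epsilon> powr (- s) + real d powr t)"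
proof -
  from assms obtain K where K: "\<And>\<epsilon> d. 0 < \<epsilon> \<Longrightarrow> \<epsilon> \<le> 1 \<Longrightarrow> 1 \<le> d \<Longrightarrow> \<epsilon>\<^sup>2 < \<mu> d 1
    \<Longrightarrow> K \<le> inverse \<epsilon> + real d \<Longrightarrow> \<bar>ln (real (complexity \<epsilon> d)) / (\<epsilon> powr (- s) + real d powr t)\<bar> < \<delta>"
    unfolding tractable_def by metis
  show thesis
  proof (rule that[of K])
    fix \<epsilon> :: real and d j :: nat
    assume *: "0 < \<epsilon>" "\<epsilon> \<le> 1" "1 \<le> d" "1 \<le> j" "\<epsilon>\<^sup>2 < \<mu> d j" "K \<le> inverse \<epsilon> + real d"
    have pos: "\<epsilon> powr (- s) + real d powr t > 0" using * by (simp add: add_pos_pos)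
    have "j \<le> complexity \<epsilon> d" using * by (intro index_le_complexity)
    then have "ln (real j) \<le> ln (real (complexity \<epsilon> d))" using *(4) by simp
    also have "\<epsilon>\<^sup>2 < \<mu> d 1" using antitone[of d 1 j] * by simp
    then have "ln (real (complexity \<epsilon> d)) < \<delta> * (\<epsilon> powr (- s) + real d powr t)"
      using K[of \<epsilon> d] * pos by (simp add: abs_less_iff pos_divide_less_eq)
    finally show "ln (real j) \<le> \<delta> * (\<epsilon> powr (- s) + real d powr t)" by simp
  qed
qed

text \<open>
  Complexity at the accuracy \<open>\<epsilon> = sqrt (\<mu> d j / 2)\<close> is at least \<open>j\<close>. For fixed \<open>d\<close> and small
  \<open>\<epsilon>\<close> the summand \<open>d powr t\<close> is dominated by \<open>\<epsilon> powr - s\<close>.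
\<close>

lemma tractable_imp_pointwise_decay:
  assumes tractable and d: "1 \<le> d"
  shows "(\<lambda>j. \<mu> d j * ln (real j) powr (2 / s)) \<longlonglongrightarrow> 0"
  unfolding tendsto_iff dist_real_def
proof safe
  fix e :: real assume e: "e > 0"
  define a where "a = (e / 4) powr (s / 2)"
  have a: "a > 0" "a powr (2 / s) = e / 4" using e s_pos by (simp_all add: a_def powr_powr)
  obtain K where K: "\<And>\<epsilon> d j. 0 < \<epsilon> \<Longrightarrow> \<epsilon> \<le> 1 \<Longrightarrow> 1 \<le> d \<Longrightarrow> 1 \<le> j \<Longrightarrow> \<epsilon>\<^sup>2 < \<mu> d j
    \<Longrightarrow> K \<le> inverse \<epsilon> + real d \<Longrightarrow> ln (real j) \<le> a / 2 * (\<epsilon> powr (- s) + real d powr t)"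
    using tractableD[OF assms(1), of "a / 2"] a(1) by auto
  \<comment> \<open>The three bounds secure \<open>\<epsilon> \<le> 1\<close>, the threshold \<open>K\<close>, and domination of \<open>d powr t\<close>.\<close>
  define e0 where "e0 = min 1 (min (inverse (max 1 K)) (real d powr (- t / s)))"
  have e0: "e0 > 0" using d by (simp add: e0_def)
  have "\<forall>\<^sub>F j in sequentially. \<mu> d j < e0\<^sup>2"
    using null[OF d] e0 by (intro order_tendstoD) auto
  then show "\<forall>\<^sub>F j in sequentially. \<bar>\<mu> d j * ln (real j) powr (2 / s) - 0\<bar> < e"
    using eventually_ge_at_top[of 1]
  proof eventually_elim
    case (elim j)
    show ?case
    proof (cases "\<mu> d j = 0")
      case False
      then have pos: "\<mu> d j > 0" using nonneg[OF d elim(2)] by simp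
      define \<epsilon> where "\<epsilon> = sqrt (\<mu> d j / 2)"
      have eps: "\<epsilon> > 0" "\<epsilon>\<^sup>2 = \<mu> d j / 2" using pos by (simp_all add: \<epsilon>_def)
      have "\<epsilon>\<^sup>2 \<le> e0\<^sup>2" using elim(1) pos unfolding eps(2) by linarith
      then have "\<epsilon> \<le> e0" using e0 by (intro power2_le_imp_le[of \<epsilon> e0]) auto
      then have le: "\<epsilon> \<le> 1" "\<epsilon> \<le> inverse (max 1 K)" "\<epsilon> \<le> real d powr (- t / s)" by (auto simp: e0_def)
      have "max 1 K \<le> inverse \<epsilon>" using le_imp_inverse_le[OF le(2) eps(1)] by simp
      then have "ln (real j) \<le> a / 2 * (\<epsilon> powr (- s) + real d powr t)"
        using elim eps le d pos by (intro K) auto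
      moreover have "(real d powr (- t / s)) powr (- s) \<le> \<epsilon> powr (- s)"
        using le(3) eps s_pos by (intro powr_mono2') auto
      then have "real d powr t \<le> \<epsilon> powr (- s)" using s_pos by (simp add: powr_powr)
      then have "a / 2 * (\<epsilon> powr (- s) + real d powr t) \<le> a / 2 * (2 * \<epsilon> powr (- s))"
        using a by (intro mult_left_mono) auto
      ultimately have "ln (real j) \<le> a * \<epsilon> powr (- s)" by simp
      then have "\<epsilon>\<^sup>2 * ln (real j) powr (2 / s) \<le> a powr (2 / s)"
        using le_mult_powr_iff[of "ln (real j)" a \<epsilon> s] elim(2) a(1) eps(1) s_pos by simp
      then have "\<mu> d j * ln (real j) powr (2 / s) \<le> e / 2" by (simp add: eps a)
      moreover have "\<mu> d j * ln (real j) powr (2 / s) \<ge> 0" using pos by simp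
      ultimately show ?thesis using e by simp
    qed (use e in simp)
  qed
qed

text \<open>
  Tractability is used with \<open>\<delta> = \<beta> / 2\<close>. For the indices in question \<open>d powr t * sqrt \<beta> \<le> ln j\<close>, so
  \<open>\<delta> * d powr t \<le> (sqrt \<beta> / 2) * ln j\<close> is at most half of \<open>ln j\<close> and can be absorbed. The factor
  \<open>2\<close> in the conclusion comes from choosing \<open>\<epsilon>\<^sup>2\<close> as half of the eigenvalue.
\<close>

lemma tractable_imp_uniform_decay:
  assumes tractable and b: "0 < \<beta>" "\<beta> < 1"
  shows "\<exists>D::nat. 1 \<le> D \<and> (\<forall>d j. D \<le> d \<longrightarrow> nat \<lceil>exp (real d powr t * sqrt \<beta>)\<rceil> + 1 \<le> j
    \<longrightarrow> \<mu> d j * ln (real j) powr (2 / s) \<le> 2 * \<beta> powr (2 / s))"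
proof -
  obtain K where K: "\<And>\<epsilon> d j. 0 < \<epsilon> \<Longrightarrow> \<epsilon> \<le> 1 \<Longrightarrow> 1 \<le> d \<Longrightarrow> 1 \<le> j \<Longrightarrow> \<epsilon>\<^sup>2 < \<mu> d j
    \<Longrightarrow> K \<le> inverse \<epsilon> + real d \<Longrightarrow> ln (real j) \<le> \<beta> / 2 * (\<epsilon> powr (- s) + real d powr t)"
    using tractableD[OF assms(1), of "\<beta> / 2"] b by auto
  show ?thesis
  proof (intro exI[of _ "max 1 (nat \<lceil>K\<rceil>)"] conjI allI impI)
    fix d j :: nat
    assume d: "max 1 (nat \<lceil>K\<rceil>) \<le> d" and j: "nat \<lceil>exp (real d powr t * sqrt \<beta>)\<rceil> + 1 \<le> j"
    define x where "x = real d powr t * sqrt \<beta>"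
    have d1: "1 \<le> d" and dK: "K \<le> real d" using d by linarith+
    have x: "x > 0" using d1 b by (simp add: x_def)
    have "exp x + 1 \<le> real j" using j unfolding x_def[symmetric] by linarith
    moreover have "exp x \<ge> 1 + x" by (rule exp_ge_add_one_self)
    ultimately have j2: "real j \<ge> exp x" "real j > 2" using x by linarith+
    then have j3: "j \<ge> 3" by simp
    then have "x \<le> ln (real j)" using j2 by (subst ln_ge_iff) auto
    have key: "ln (real j) \<le> \<beta> * \<epsilon> powr (- s)"
      if e: "0 < \<epsilon>" "\<epsilon> \<le> 1" "\<epsilon>\<^sup>2 < \<mu> d j" for \<epsilon>
    proof -
      have "ln (real j) \<le> \<beta> / 2 * (\<epsilon> powr (- s) + real d powr t)"
        using e j3 d1 dK by (intro K) (auto simp: add_increasing)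
      moreover have "\<beta> * real d powr t = sqrt \<beta> * x"
        using b by (simp add: x_def real_sqrt_mult_self flip: mult.assoc)
      moreover have "sqrt \<beta> * x \<le> 1 * x" using b x by (intro mult_right_mono) auto
      ultimately show ?thesis using \<open>x \<le> ln (real j)\<close> by (simp add: algebra_simps)
    qed
    \<comment> \<open>A larger eigenvalue would admit \<open>\<epsilon> = 1\<close>, and then \<open>ln j \<le> \<beta> < 1\<close>, although \<open>j \<ge> 3\<close>.\<close>
    have "\<mu> d j \<le> 1"
    proof (rule ccontr)
      assume "\<not> \<mu> d j \<le> 1"
      then have "ln (real j) \<le> \<beta>" using key[of 1] by simp
      moreover have "exp 1 < real j" using j3 e_less_272 by linarith
      then have "ln (real j) > 1" using ln_less_cancel_iff[of "exp 1" "real j"] j3 by simp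
      ultimately show False using b by simp
    qed
    show "\<mu> d j * ln (real j) powr (2 / s) \<le> 2 * \<beta> powr (2 / s)"
    proof (cases "\<mu> d j = 0")
      case False
      then have pos: "\<mu> d j > 0" using nonneg[OF d1, of j] j3 by simp
      define \<epsilon> where "\<epsilon> = sqrt (\<mu> d j / 2)"
      have eps: "\<epsilon> > 0" "\<epsilon>\<^sup>2 = \<mu> d j / 2" using pos by (simp_all add: \<epsilon>_def)
      have "\<epsilon> \<le> 1" using eps \<open>\<mu> d j \<le> 1\<close> by (intro power2_le_imp_le[of \<epsilon> 1]) auto
      then have "ln (real j) \<le> \<beta> * \<epsilon> powr (- s)" using eps pos by (intro key) auto
      then have "\<epsilon>\<^sup>2 * ln (real j) powr (2 / s) \<le> \<beta> powr (2 / s)"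
        using le_mult_powr_iff[of "ln (real j)" \<beta> \<epsilon> s] j3 b(1) eps(1) s_pos by simp
      then show ?thesis by (simp add: eps)
    qed simp
  qed simp
qed

text \<open>
  Fix \<open>\<delta>\<close> and choose \<open>\<beta>\<close> so small that both \<open>sqrt \<beta>\<close> and the constant in the uniform
  decay are small against \<open>\<delta>\<close>. If \<open>d \<ge> f \<beta>\<close>, the complexity \<open>n\<close> is either at most about
  \<open>exp (d powr t * sqrt \<beta>)\<close>, or large enough for the uniform decay to give
  \<open>ln n \<le> L' * \<beta> * \<epsilon> powr - s\<close>. The finitely many smaller \<open>d\<close> share one index \<open>Jm\<close> beyond which
  pointwise decay applies; bounded complexities are absorbed as \<open>\<epsilon> powr - s + d powr t\<close> grows.
\<close>

lemma decay_imp_tractable: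
  assumes b: "0 < \<beta>bar"
    and pointwise: "\<And>d. 1 \<le> d \<Longrightarrow> (\<lambda>j. \<mu> d j * ln (real j) powr (2 / s)) \<longlonglongrightarrow> 0"
    and unif: "\<And>\<beta> d j. 0 < \<beta> \<Longrightarrow> \<beta> \<le> \<beta>bar \<Longrightarrow> 1 \<le> d \<Longrightarrow> f \<beta> \<le> d \<Longrightarrow>
      nat \<lceil>exp (real d powr t * sqrt \<beta>)\<rceil> + 1 \<le> j \<Longrightarrow> \<mu> d j * ln (real j) powr (2 / s) \<le> L * \<beta> powr (2 / s)"
  shows tractable
  unfolding tractable_def
proof (intro allI impI)
  fix \<delta> :: real assume \<delta>: "\<delta> > 0"
  define L' where "L' = (max L 1) powr (s / 2)"
  have L': "L' > 0" "L' powr (2 / s) = max L 1" using s_pos by (auto simp: L'_def powr_powr)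
  define \<beta> where "\<beta> = min \<beta>bar (min ((\<delta> / 4)\<^sup>2) (\<delta> / (2 * L')))"
  have \<beta>: "0 < \<beta>" "\<beta> \<le> \<beta>bar" "\<beta> \<le> (\<delta> / 4)\<^sup>2" "\<beta> \<le> \<delta> / (2 * L')"
    using b \<delta> L' by (auto simp: \<beta>_def)
  have sb: "sqrt \<beta> \<le> \<delta> / 4" using \<beta>(3) \<delta> by (intro real_le_lsqrt) auto
  have Lb: "L' * \<beta> \<le> \<delta> / 2" using \<beta>(4) L' by (simp add: field_simps)
  have "\<exists>J. \<forall>j\<ge>J. \<mu> d j * ln (real j) powr (2 / s) \<le> (\<delta> / 4) powr (2 / s)" if "1 \<le> d" for d
  proof -
    have "\<forall>\<^sub>F j in sequentially. \<mu> d j * ln (real j) powr (2 / s) < (\<delta> / 4) powr (2 / s)"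
      using pointwise[OF that] \<delta> by (intro order_tendstoD) auto
    then show ?thesis unfolding eventually_sequentially by (meson less_imp_le)
  qed
  then obtain J where J: "\<And>d j. 1 \<le> d \<Longrightarrow> J d \<le> j \<Longrightarrow> \<mu> d j * ln (real j) powr (2 / s) \<le> (\<delta> / 4) powr (2 / s)"
    by metis
  define Jm where "Jm = Max (insert 1 (J ` {..f \<beta>}))"
  have Jm: "1 \<le> Jm" "\<And>d. d \<le> f \<beta> \<Longrightarrow> J d \<le> Jm" by (simp_all add: Jm_def del: Max_insert)
  obtain K where K: "\<And>\<epsilon> d::nat. 0 < \<epsilon> \<Longrightarrow> K \<le> inverse \<epsilon> + real d \<Longrightarrow>
      4 / \<delta> * (1 + ln (real Jm)) \<le> \<epsilon> powr (- s) + real d powr t"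
    using powr_sum_large[OF s_pos t_pos] by metis
  show "\<exists>K. \<forall>\<epsilon> d. (0 < \<epsilon> \<and> \<epsilon> \<le> 1 \<and> 1 \<le> d \<and> \<epsilon>\<^sup>2 < \<mu> d 1) \<and> K \<le> inverse \<epsilon> + real d
     \<longrightarrow> \<bar>ln (real (complexity \<epsilon> d)) / (\<epsilon> powr (- s) + real d powr t)\<bar> < \<delta>"
  proof (intro exI[of _ K] allI impI, elim conjE)
    fix \<epsilon> :: real and d :: nat
    assume e: "0 < \<epsilon>" "\<epsilon> \<le> 1" and d: "1 \<le> d" and init: "\<epsilon>\<^sup>2 < \<mu> d 1" and "K \<le> inverse \<epsilon> + real d"
    define n where "n = complexity \<epsilon> d"
    define w where "w = \<epsilon> powr (- s) + real d powr t"
    have n: "1 \<le> n" unfolding n_def using index_le_complexity[OF d e(1), of 1] init by simp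
    have mu: "\<epsilon>\<^sup>2 < \<mu> d n" using less_spectrum_at_complexity n unfolding n_def by blast
    have w: "w > 0" "\<epsilon> powr (- s) \<le> w" "real d powr t \<le> w" using d e by (auto simp: w_def add_pos_pos)
    have "4 / \<delta> * (1 + ln (real Jm)) \<le> w" unfolding w_def by (rule K) fact+
    then have const: "1 + ln (real Jm) \<le> \<delta> / 4 * w" using \<delta> by (simp add: field_simps)
    have ln_bound: "ln (real n) \<le> a * \<epsilon> powr (- s)"
      if a: "\<mu> d n * ln (real n) powr (2 / s) \<le> a powr (2 / s)" "a > 0" for a
    proof -
      have "\<epsilon>\<^sup>2 * ln (real n) powr (2 / s) \<le> \<mu> d n * ln (real n) powr (2 / s)"
        using mu by (intro mult_right_mono) auto
      then show ?thesis using a n e s_pos by (subst le_mult_powr_iff) auto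
    qed
    have "ln (real n) \<le> \<delta> / 2 * w"
    proof (cases "f \<beta> \<le> d")
      case True
      define x where "x = real d powr t * sqrt \<beta>"
      show ?thesis
      proof (cases "nat \<lceil>exp x\<rceil> + 1 \<le> n")
        case n': True
        have "\<mu> d n * ln (real n) powr (2 / s) \<le> L * \<beta> powr (2 / s)"
          using unif[OF \<beta>(1,2) d True] n' by (simp add: x_def)
        also have "\<dots> \<le> max L 1 * \<beta> powr (2 / s)" by (intro mult_right_mono) auto
        also have "\<dots> = (L' * \<beta>) powr (2 / s)" using L' \<beta> by (simp add: powr_mult)
        finally have "ln (real n) \<le> L' * \<beta> * \<epsilon> powr (- s)" using L' \<beta> by (intro ln_bound) auto
        also have "\<dots> \<le> \<delta> / 2 * w" using Lb w \<delta> by (intro mult_mono) auto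
        finally show ?thesis .
      next
        case False
        have "x \<ge> 0" using \<beta>(1) by (simp add: x_def)
        then have "exp x \<ge> 1" by simp
        have "real n \<le> of_int \<lceil>exp x\<rceil>" using False \<open>exp x \<ge> 1\<close> by linarith
        also have "\<dots> \<le> exp x + 1" by linarith
        also have "\<dots> \<le> exp 1 * exp x"
          using \<open>exp x \<ge> 1\<close> exp_ge_add_one_self[of 1] mult_right_mono[of 2 "exp 1" "exp x"] by linarith
        also have "\<dots> = exp (1 + x)" by (simp add: exp_add)
        finally have "ln (real n) \<le> 1 + x" using n ln_le_cancel_iff[of "real n" "exp (1 + x)"] by simp
        moreover have "x \<le> w * (\<delta> / 4)" unfolding x_def using w sb \<delta> \<beta> by (intro mult_mono) auto
        moreover have "ln (real Jm) \<ge> 0" using Jm(1) by simp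
        ultimately show ?thesis using const by (simp add: field_simps)
      qed
    next
      case False
      show ?thesis
      proof (cases "Jm \<le> n")
        case True
        then have "J d \<le> n" using Jm(2)[of d] False by linarith
        then have "ln (real n) \<le> \<delta> / 4 * \<epsilon> powr (- s)" using J[OF d] \<delta> by (intro ln_bound) auto
        also have "\<dots> \<le> \<delta> / 2 * w" using w \<delta> by (intro mult_mono) auto
        finally show ?thesis .
      next
        case False
        then have "ln (real n) \<le> ln (real Jm)" using n by simp
        also have "\<dots> \<le> \<delta> / 4 * w" using const by simp
        also have "\<dots> \<le> \<delta> / 2 * w" using w \<delta> by (intro mult_right_mono) auto
        finally show ?thesis .
      qed
    qed
    moreover have "ln (real n) \<ge> 0" using n by simp
    moreover have "\<delta> / 2 * w < \<delta> * w" using w \<delta> by simp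
    ultimately have "\<bar>ln (real n)\<bar> < \<delta> * w" by linarith
    then have "\<bar>ln (real n) / w\<bar> < \<delta>" using w by (simp add: abs_divide pos_divide_less_eq)
    then show "\<bar>ln (real (complexity \<epsilon> d)) / (\<epsilon> powr (- s) + real d powr t)\<bar> < \<delta>" by (simp only: n_def w_def)
  qed
qed

end

text \<open>
  Replaces the finiteness of the iterated supremum by real inequalities; multiplication by the positive
  weights \<open>1 / w x\<close> is monotone on the extended reals.
\<close>

lemma scaled_SUP_finite_iff:
  fixes w :: "'a \<Rightarrow> real" and g :: "'b \<Rightarrow> 'c \<Rightarrow> real"
  assumes w: "\<And>x. x \<in> A \<Longrightarrow> w x > 0"
  shows "(SUP x\<in>A. ereal (1 / w x) * (SUP d\<in>D x. SUP j\<in>J x d. ereal (g d j))) < \<infinity> \<longleftrightarrow>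
    (\<exists>L. \<forall>x\<in>A. \<forall>d\<in>D x. \<forall>j\<in>J x d. g d j \<le> L * w x)" (is "?S < \<infinity> \<longleftrightarrow> ?bound")
proof
  assume "?S < \<infinity>"
  then obtain L where L: "?S \<le> ereal L"
    by (cases ?S) (auto intro: that)
  have "g d j \<le> L * w x" if x: "x \<in> A" "d \<in> D x" "j \<in> J x d" for x d j
  proof -
    let ?I = "SUP d\<in>D x. SUP j\<in>J x d. ereal (g d j)"
    have "ereal (g d j) \<le> ?I" using x(2,3) by (intro SUP_upper2[of d] SUP_upper)
    then have "ereal (1 / w x) * ereal (g d j) \<le> ereal (1 / w x) * ?I"
      using w[OF x(1)] by (intro ereal_mult_left_mono) auto
    also have "\<dots> \<le> ?S" using x(1) by (rule SUP_upper)
    also note L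
    finally have "g d j / w x \<le> L" by simp
    then show ?thesis using w[OF x(1)] by (simp add: pos_divide_le_eq)
  qed
  then show ?bound by blast
next
  assume ?bound
  then obtain L where L: "\<And>x d j. x \<in> A \<Longrightarrow> d \<in> D x \<Longrightarrow> j \<in> J x d \<Longrightarrow> g d j \<le> L * w x" by blast
  have "?S \<le> ereal L"
  proof (rule SUP_least)
    fix x assume x: "x \<in> A"
    have "(SUP d\<in>D x. SUP j\<in>J x d. ereal (g d j)) \<le> ereal (L * w x)"
      using L[OF x] by (intro SUP_least) simp
    then have "ereal (1 / w x) * (SUP d\<in>D x. SUP j\<in>J x d. ereal (g d j)) \<le> ereal (1 / w x) * ereal (L * w x)"
      using w[OF x] by (intro ereal_mult_left_mono) auto
    also have "\<dots> = ereal L" using w[OF x] by simp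
    finally show "ereal (1 / w x) * (SUP d\<in>D x. SUP j\<in>J x d. ereal (g d j)) \<le> ereal L" .
  qed
  then show "?S < \<infinity>" by (rule order.strict_trans1) simp
qed

theorem theorem3p1:
  fixes scH :: "'k::{real_normed_field,banach} \<Rightarrow> 'h::real_inner \<Rightarrow> 'h"
    and scG :: "'k \<Rightarrow> 'g::real_inner \<Rightarrow> 'g"
    and H :: "nat \<Rightarrow> 'h set" and G :: "nat \<Rightarrow> 'g set"
    and S :: "nat \<Rightarrow> 'h \<Rightarrow> 'g"
    and lam :: "nat \<Rightarrow> nat \<Rightarrow> real"
    and crit :: criterion
    and s t \<beta>bar :: real
  assumes "hilbert_scalars scH" and "hilbert_scalars scG"
    and "\<And>d. d \<ge> 1 \<Longrightarrow> hilbert_space_on scH (H d)"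
    and "\<And>d. d \<ge> 1 \<Longrightarrow> infinite_dimensional_on scH (H d)"
    and "\<And>d. d \<ge> 1 \<Longrightarrow> separable_space (top_of_set (H d))"
    and "\<And>d. d \<ge> 1 \<Longrightarrow> hilbert_space_on scG (G d)"
    and "\<And>d. d \<ge> 1 \<Longrightarrow> compact_operator_on scH scG (H d) (G d) (S d)"
    and "\<And>d. d \<ge> 1 \<Longrightarrow> ordered_eigenvalues_on scH (H d) (adjoint_on (H d) (S d) \<circ> S d) (lam d)"
    and "\<And>d. d \<ge> 1 \<Longrightarrow> lam d 1 > 0"
    and "s > 0" and "t > 0" and "0 < \<beta>bar" and "\<beta>bar < 1"
  shows "weakly_tractable scH scG H G crit s t S \<longleftrightarrow>
    (\<forall>d\<ge>1. (\<lambda>j. lam d j / CRI crit lam d * ln (real j) powr (2 / s)) \<longlonglongrightarrow> 0) \<and>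
    (\<exists>f \<in> {0<..\<beta>bar} \<rightarrow> {1::nat..}.
       (SUP \<beta>\<in>{0<..\<beta>bar}. ereal (1 / \<beta> powr (2 / s)) *
          (SUP d\<in>{d. 1 \<le> d \<and> f \<beta> \<le> d}.
             SUP j\<in>{j. nat \<lceil>exp (real d powr t * sqrt \<beta>)\<rceil> + 1 \<le> j}.
               ereal (lam d j / CRI crit lam d * ln (real j) powr (2 / s)))) < \<infinity>)"
proof -
  have spectrum: "hilbert_compact_operator_spectrum scH scG (H d) (G d) (S d) (lam d)" if "1 \<le> d" for d
    using assms(1-3,7,8) that
    by (simp add: hilbert_compact_operator_spectrum_def hilbert_compact_operator_def
        hilbert_compact_operator_axioms_def hilbert_compact_operator_spectrum_axioms_def)
  have error: "minimal_error scH scG (H d) (G d) (S d) n = sqrt (lam d (Suc n))" if "1 \<le> d" for d n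
    by (rule hilbert_compact_operator_spectrum.minimal_error_eq[OF spectrum[OF that]])
  define \<mu> where "\<mu> d j = lam d j / CRI crit lam d" for d j
  have CRI: "CRI crit lam d > 0" if "1 \<le> d" for d
    using assms(9)[OF that] by (cases crit) (simp_all add: CRI_def)
  interpret spectrum_family \<mu> s t
  proof
    fix d i j :: nat assume d: "1 \<le> d"
    note d_facts = hilbert_compact_operator_spectrum.lam_antitone[OF spectrum[OF d]]
      hilbert_compact_operator_spectrum.lam_nonneg[OF spectrum[OF d]]
      hilbert_compact_operator_spectrum.lam_null[OF spectrum[OF d]]
    show "\<mu> d j \<le> \<mu> d i" if "1 \<le> i" "i \<le> j"
      unfolding \<mu>_def using d_facts(1)[OF that] CRI[OF d] by (simp add: divide_right_mono)
    show "0 \<le> \<mu> d j" if "1 \<le> j"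
      unfolding \<mu>_def using d_facts(2)[OF that] CRI[OF d] by simp
    show "\<mu> d \<longlonglongrightarrow> 0"
      using tendsto_divide[OF d_facts(3) tendsto_const[of "CRI crit lam d"]] CRI[OF d]
      unfolding \<mu>_def[abs_def] by simp
  qed (use assms(10,11) in auto)

  \<comment> \<open>The condition \<open>\<epsilon>\<^sup>2 < \<mu> d 1\<close> expresses, for both criteria, that \<open>\<epsilon>\<close> lies below the initial error.\<close>
  have admissible: "\<epsilon> < (case crit of Absolute \<Rightarrow> minimal_error scH scG (H d) (G d) (S d) 0
      | Normalized \<Rightarrow> 1) \<longleftrightarrow> \<epsilon>\<^sup>2 < \<mu> d 1" if "0 < \<epsilon>" "1 \<le> d" for \<epsilon> d
  proof (cases crit)
    case Absolute
    have "\<epsilon> < sqrt (lam d 1) \<longleftrightarrow> \<epsilon>\<^sup>2 < lam d 1"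
      using that(1) real_sqrt_less_iff[of "\<epsilon>\<^sup>2" "lam d 1"] by simp
    then show ?thesis using Absolute error[OF that(2)] by (simp add: \<mu>_def CRI_def)
  next
    case Normalized
    have "\<epsilon> < 1 \<longleftrightarrow> \<epsilon>\<^sup>2 < 1" using that(1) by (simp add: abs_square_less_1)
    then show ?thesis using Normalized assms(9)[OF that(2)] by (simp add: \<mu>_def CRI_def)
  qed
  have complexity_eq: "information_complexity scH scG (H d) (G d) crit \<epsilon> (S d) = complexity \<epsilon> d"
    if "0 < \<epsilon>" "1 \<le> d" for \<epsilon> d
  proof -
    have "sqrt x \<le> (case crit of Absolute \<Rightarrow> \<epsilon> | Normalized \<Rightarrow> \<epsilon> * sqrt (lam d (Suc 0))) \<longleftrightarrow>
      x / CRI crit lam d \<le> \<epsilon>\<^sup>2" for x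
    proof -
      have *: "sqrt x \<le> y \<longleftrightarrow> x \<le> y\<^sup>2" if "0 < y" for y
        using that real_sqrt_le_iff[of x "y\<^sup>2"] by simp
      show ?thesis
        using *[of \<epsilon>] *[of "\<epsilon> * sqrt (lam d 1)"] that(1) assms(9)[OF that(2)]
        by (cases crit) (simp_all add: CRI_def power_mult_distrib pos_divide_le_eq)
    qed
    then show ?thesis
      unfolding information_complexity_def complexity_def \<mu>_def error[OF that(2)] by (simp only:)
  qed
  have tractable_iff: "weakly_tractable scH scG H G crit s t S \<longleftrightarrow> tractable"
  proof -
    have "weakly_tractable scH scG H G crit s t S \<longleftrightarrow>
      (\<forall>(\<epsilon>::nat \<Rightarrow> real) (d::nat \<Rightarrow> nat).
        (\<forall>k. 0 < \<epsilon> k \<and> \<epsilon> k \<le> 1 \<and> 1 \<le> d k \<and> (\<epsilon> k)\<^sup>2 < \<mu> (d k) 1) \<and>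
        filterlim (\<lambda>k. inverse (\<epsilon> k) + real (d k)) at_top sequentially \<longrightarrow>
        (\<lambda>k. ln (real (complexity (\<epsilon> k) (d k))) / (\<epsilon> k powr (- s) + real (d k) powr t)) \<longlonglongrightarrow> 0)"
      unfolding weakly_tractable_def
    proof (rule iff_allI, rule iff_allI, rule imp_cong, rule conj_cong[OF _ refl])
      fix \<epsilon> :: "nat \<Rightarrow> real" and d :: "nat \<Rightarrow> nat"
      show "(\<forall>k. 0 < \<epsilon> k \<and> \<epsilon> k \<le> 1 \<and> 1 \<le> d k \<and>
             \<epsilon> k < (case crit of Absolute \<Rightarrow> minimal_error scH scG (H (d k)) (G (d k)) (S (d k)) 0
                               | Normalized \<Rightarrow> 1)) \<longleftrightarrow>
        (\<forall>k. 0 < \<epsilon> k \<and> \<epsilon> k \<le> 1 \<and> 1 \<le> d k \<and> (\<epsilon> k)\<^sup>2 < \<mu> (d k) 1)"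
        by (rule iff_allI, intro conj_cong refl admissible)
      assume "(\<forall>k. 0 < \<epsilon> k \<and> \<epsilon> k \<le> 1 \<and> 1 \<le> d k \<and> (\<epsilon> k)\<^sup>2 < \<mu> (d k) 1) \<and>
        filterlim (\<lambda>k. inverse (\<epsilon> k) + real (d k)) at_top sequentially"
      then have "\<And>k. 0 < \<epsilon> k" "\<And>k. 1 \<le> d k" by simp_all
      then show "((\<lambda>k. ln (real (information_complexity scH scG (H (d k)) (G (d k)) crit (\<epsilon> k) (S (d k)))) /
             (\<epsilon> k powr (- s) + real (d k) powr t)) \<longlonglongrightarrow> 0) \<longleftrightarrow>
        ((\<lambda>k. ln (real (complexity (\<epsilon> k) (d k))) / (\<epsilon> k powr (- s) + real (d k) powr t)) \<longlonglongrightarrow> 0)"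
        by (simp only: complexity_eq)
    qed
    also have "\<dots> \<longleftrightarrow> tractable"
      unfolding tractable_def
      by (rule sequential_null_limit_iff[where P = "\<lambda>\<epsilon> d. 0 < \<epsilon> \<and> \<epsilon> \<le> 1 \<and> 1 \<le> d \<and> \<epsilon>\<^sup>2 < \<mu> d 1"
            and sz = "\<lambda>\<epsilon> d. inverse \<epsilon> + real d"
            and F = "\<lambda>\<epsilon> d. ln (real (complexity \<epsilon> d)) / (\<epsilon> powr (- s) + real d powr t)"])
    finally show ?thesis .
  qed
  have sup_iff: "(SUP \<beta>\<in>{0<..\<beta>bar}. ereal (1 / \<beta> powr (2 / s)) *
          (SUP d\<in>{d. 1 \<le> d \<and> f \<beta> \<le> d}.
             SUP j\<in>{j. nat \<lceil>exp (real d powr t * sqrt \<beta>)\<rceil> + 1 \<le> j}.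
               ereal (\<mu> d j * ln (real j) powr (2 / s)))) < \<infinity> \<longleftrightarrow>
      (\<exists>L. \<forall>\<beta>\<in>{0<..\<beta>bar}. \<forall>d\<in>{d. 1 \<le> d \<and> f \<beta> \<le> d}.
         \<forall>j\<in>{j. nat \<lceil>exp (real d powr t * sqrt \<beta>)\<rceil> + 1 \<le> j}.
           \<mu> d j * ln (real j) powr (2 / s) \<le> L * \<beta> powr (2 / s))" for f :: "real \<Rightarrow> nat"
    by (rule scaled_SUP_finite_iff) simp
  show ?thesis
    unfolding tractable_iff \<mu>_def[symmetric] sup_iff
  proof (intro iffI conjI)
    assume tr: tractable
    then show "\<forall>d\<ge>1. (\<lambda>j. \<mu> d j * ln (real j) powr (2 / s)) \<longlonglongrightarrow> 0"
      by (intro allI impI tractable_imp_pointwise_decay)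
    have "\<exists>D::nat. 1 \<le> D \<and> (\<forall>d j. D \<le> d \<longrightarrow> nat \<lceil>exp (real d powr t * sqrt \<beta>)\<rceil> + 1 \<le> j
      \<longrightarrow> \<mu> d j * ln (real j) powr (2 / s) \<le> 2 * \<beta> powr (2 / s))" if "\<beta> \<in> {0<..\<beta>bar}" for \<beta>
    proof -
      have "0 < \<beta>" "\<beta> < 1" using that assms(13) by auto
      then show ?thesis by (rule tractable_imp_uniform_decay[OF tr])
    qed
    then have "\<exists>f. \<forall>\<beta>\<in>{0<..\<beta>bar}. (1::nat) \<le> f \<beta> \<and> (\<forall>d j. f \<beta> \<le> d \<longrightarrow>
      nat \<lceil>exp (real d powr t * sqrt \<beta>)\<rceil> + 1 \<le> j
      \<longrightarrow> \<mu> d j * ln (real j) powr (2 / s) \<le> 2 * \<beta> powr (2 / s))"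
      by (intro bchoice ballI)
    then obtain f where f: "\<forall>\<beta>\<in>{0<..\<beta>bar}. (1::nat) \<le> f \<beta> \<and> (\<forall>d j. f \<beta> \<le> d \<longrightarrow>
      nat \<lceil>exp (real d powr t * sqrt \<beta>)\<rceil> + 1 \<le> j
      \<longrightarrow> \<mu> d j * ln (real j) powr (2 / s) \<le> 2 * \<beta> powr (2 / s))" ..
    show "\<exists>f\<in>{0<..\<beta>bar} \<rightarrow> {1::nat..}. \<exists>L. \<forall>\<beta>\<in>{0<..\<beta>bar}. \<forall>d\<in>{d. 1 \<le> d \<and> f \<beta> \<le> d}.
         \<forall>j\<in>{j. nat \<lceil>exp (real d powr t * sqrt \<beta>)\<rceil> + 1 \<le> j}.
           \<mu> d j * ln (real j) powr (2 / s) \<le> L * \<beta> powr (2 / s)"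
    proof (intro bexI[of _ f] exI[of _ 2] ballI)
      show "f \<in> {0<..\<beta>bar} \<rightarrow> {1..}" using f by (intro Pi_I) simp
      show "\<mu> d j * ln (real j) powr (2 / s) \<le> 2 * \<beta> powr (2 / s)"
        if "\<beta> \<in> {0<..\<beta>bar}" "d \<in> {d. 1 \<le> d \<and> f \<beta> \<le> d}"
          "j \<in> {j. nat \<lceil>exp (real d powr t * sqrt \<beta>)\<rceil> + 1 \<le> j}" for \<beta> d j
        using f that unfolding mem_Collect_eq by blast
    qed
  next
    assume "(\<forall>d\<ge>1. (\<lambda>j. \<mu> d j * ln (real j) powr (2 / s)) \<longlonglongrightarrow> 0) \<and>
      (\<exists>f\<in>{0<..\<beta>bar} \<rightarrow> {1::nat..}. \<exists>L. \<forall>\<beta>\<in>{0<..\<beta>bar}. \<forall>d\<in>{d. 1 \<le> d \<and> f \<beta> \<le> d}.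
         \<forall>j\<in>{j. nat \<lceil>exp (real d powr t * sqrt \<beta>)\<rceil> + 1 \<le> j}.
           \<mu> d j * ln (real j) powr (2 / s) \<le> L * \<beta> powr (2 / s))"
    then obtain f :: "real \<Rightarrow> nat" and L
      where pointwise: "\<forall>d\<ge>1. (\<lambda>j. \<mu> d j * ln (real j) powr (2 / s)) \<longlonglongrightarrow> 0"
        and unif: "\<forall>\<beta>\<in>{0<..\<beta>bar}. \<forall>d\<in>{d. 1 \<le> d \<and> f \<beta> \<le> d}.
         \<forall>j\<in>{j. nat \<lceil>exp (real d powr t * sqrt \<beta>)\<rceil> + 1 \<le> j}.
           \<mu> d j * ln (real j) powr (2 / s) \<le> L * \<beta> powr (2 / s)"
      by (elim conjE bexE exE)
    show tractable
    proof (rule decay_imp_tractable[OF assms(12)])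
      show "(\<lambda>j. \<mu> d j * ln (real j) powr (2 / s)) \<longlonglongrightarrow> 0" if "1 \<le> d" for d
        using pointwise that by blast
      show "\<mu> d j * ln (real j) powr (2 / s) \<le> L * \<beta> powr (2 / s)"
        if "0 < \<beta>" "\<beta> \<le> \<beta>bar" "1 \<le> d" "f \<beta> \<le> d"
          "nat \<lceil>exp (real d powr t * sqrt \<beta>)\<rceil> + 1 \<le> j" for \<beta> d j
        using unif that unfolding greaterThanAtMost_iff mem_Collect_eq Ball_def by blast
    qed
  qed
qed

end
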